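(* Let $\mathcal H$ be a real separable Hilbert space with closed unit ball $B$, let $(\Omega,\mathcal F,\mathbb P)$ be a probability space with filtration $(\mathcal F_n)_{n\in\mathbb N}$, let $(X_n)_{n\ge 1}$ be a predictable $B$-valued sequence, and let $(Y_n)_{n\ge 1}$ be an adapted real-valued sequence with $\mathbb E[Y_n\mid\mathcal F_{n-1}]=0$ and $|Y_n|\le 1$ almost surely for all $n\ge1$. Define $M_n=\sum_{j=1}^n Y_jX_j$, $Q_n=\sum_{j=1}^n\mathbb E[Y_j^2\mid\mathcal F_{j-1}]\,X_j\otimes X_j$, $V_n=\sum_{j=1}^n X_j\otimes X_j$ and, for $\rho\ge1$, $Z_n(\rho)=\|(Q_n+\rho I)^{-1/2}M_n\|$. Fix $\rho\ge 1$. Then for every $y>0$, $$\mathbb P\left[\exists n\ge 1:\ Z_n(\rho)>\sqrt{\rho}+\frac{78\,\gamma(\rho^{-1}V_n)+4y}{\sqrt{\rho}}+\sqrt{18\,\gamma(\rho^{-1}V_n)+6y}\,\right]\le 2e^{-y}.$$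
   Context: $\mathbb N=\{0,1,2,\dots\}$. Predictable means $X_n$ is $\mathcal F_{n-1}$-measurable for each $n\ge1$; adapted means $Y_n$ is $\mathcal F_n$-measurable. $I$ is the identity operator on $\mathcal H$, and $x\otimes x$ is the rank-one operator $z\mapsto\langle x,z\rangle x$. For a positive semidefinite trace class operator $A$ on $\mathcal H$, the information gain is $\gamma(A)=\tfrac12\log\det(I+A)$, where $\det$ is the Fredholm determinant. *)

theory Defs
  imports "HOL-Probability.Probability" "HOL-Combinatorics.Permutations"
begin

section \<open>Operators on a real Hilbert space\<close>

definition rank_one :: "'a::real_inner \<Rightarrow> 'a \<Rightarrow>\<^sub>L 'a" where
  "rank_one x = blinfun_scaleR_left x o\<^sub>L blinfun_inner_right x"

lemma rank_one_apply: "blinfun_apply (rank_one x) z = (x \<bullet> z) *\<^sub>R x"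
  by (simp add: rank_one_def)

definition positive_op :: "('a::real_inner \<Rightarrow>\<^sub>L 'a) \<Rightarrow> bool" where
  "positive_op T \<longleftrightarrow>
     (\<forall>x y. blinfun_apply T x \<bullet> y = x \<bullet> blinfun_apply T y) \<and> (\<forall>x. 0 \<le> x \<bullet> blinfun_apply T x)"

text \<open>The operator \<open>T\<close> to the power \<open>-1/2\<close>: the positive square root of the (two-sided) inverse of
  \<open>T\<close>. It exists and is unique if \<open>T\<close> is positive and boundedly invertible on a Hilbert space, and
  it is a fixed unspecified operator for all other \<open>T\<close>.\<close>

definition inv_sqrt_op :: "('a::real_inner \<Rightarrow>\<^sub>L 'a) \<Rightarrow> ('a \<Rightarrow>\<^sub>L 'a)" where
  "inv_sqrt_op T =
     (THE S. positive_op S \<and> (S o\<^sub>L S) o\<^sub>L T = id_blinfun \<and> T o\<^sub>L (S o\<^sub>L S) = id_blinfun)"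

section \<open>Fredholm determinant and information gain\<close>

definition orthonormal_basis :: "'a::real_inner set \<Rightarrow> bool" where
  "orthonormal_basis E \<longleftrightarrow>
     (\<forall>e\<in>E. norm e = 1) \<and> (\<forall>e\<in>E. \<forall>f\<in>E. e \<noteq> f \<longrightarrow> e \<bullet> f = 0) \<and> closure (span E) = UNIV"

definition principal_minor :: "('a::real_inner \<Rightarrow>\<^sub>L 'a) \<Rightarrow> 'a set \<Rightarrow> real" where
  "principal_minor A S =
     (\<Sum>p | p permutes S. of_int (sign p) * (\<Prod>e\<in>S. e \<bullet> blinfun_apply A (p e)))"

text \<open>The Fredholm determinant of \<open>I + A\<close> for a trace class operator \<open>A\<close> is the sum over
  \<open>k \<ge> 0\<close> of the traces of the exterior powers of \<open>A\<close>. For an orthonormal basis \<open>E\<close>, the \<open>k\<close>-th of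
  these traces is the sum of the principal minors of the matrix of \<open>A\<close> over the \<open>k\<close>-element subsets
  of \<open>E\<close>. The whole double series converges absolutely and does not depend on \<open>E\<close>.\<close>

definition fredholm_det_plus_id :: "('a::real_inner \<Rightarrow>\<^sub>L 'a) \<Rightarrow> real" where
  "fredholm_det_plus_id A =
     (let E = (SOME E. orthonormal_basis E)
      in \<Sum>\<^sub>\<infinity>S\<in>{S. finite S \<and> S \<subseteq> E}. principal_minor A S)"

definition info_gain :: "('a::real_inner \<Rightarrow>\<^sub>L 'a) \<Rightarrow> real" where
  "info_gain A = (1/2) * ln (fredholm_det_plus_id A)"

section \<open>The self-normalised process\<close>

definition mart_sum ::
  "(nat \<Rightarrow> 'w \<Rightarrow> 'a::real_inner) \<Rightarrow> (nat \<Rightarrow> 'w \<Rightarrow> real) \<Rightarrow> nat \<Rightarrow> 'w \<Rightarrow> 'a" where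
  "mart_sum X Y n \<omega> = (\<Sum>j=1..n. Y j \<omega> *\<^sub>R X j \<omega>)"

definition pred_quad_var ::
  "'w measure \<Rightarrow> (nat \<Rightarrow> 'w measure) \<Rightarrow> (nat \<Rightarrow> 'w \<Rightarrow> 'a::real_inner) \<Rightarrow> (nat \<Rightarrow> 'w \<Rightarrow> real)
     \<Rightarrow> nat \<Rightarrow> 'w \<Rightarrow> ('a \<Rightarrow>\<^sub>L 'a)" where
  "pred_quad_var P F X Y n \<omega> =
     (\<Sum>j=1..n. real_cond_exp P (F (j - 1)) (\<lambda>\<eta>. (Y j \<eta>)\<^sup>2) \<omega> *\<^sub>R rank_one (X j \<omega>))"

definition gram_op :: "(nat \<Rightarrow> 'w \<Rightarrow> 'a::real_inner) \<Rightarrow> nat \<Rightarrow> 'w \<Rightarrow> ('a \<Rightarrow>\<^sub>L 'a)" where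
  "gram_op X n \<omega> = (\<Sum>j=1..n. rank_one (X j \<omega>))"

definition self_norm ::
  "'w measure \<Rightarrow> (nat \<Rightarrow> 'w measure) \<Rightarrow> (nat \<Rightarrow> 'w \<Rightarrow> 'a::real_inner) \<Rightarrow> (nat \<Rightarrow> 'w \<Rightarrow> real)
     \<Rightarrow> real \<Rightarrow> nat \<Rightarrow> 'w \<Rightarrow> real" where
  "self_norm P F X Y \<rho> n \<omega> =
     norm (blinfun_apply (inv_sqrt_op (pred_quad_var P F X Y n \<omega> + \<rho> *\<^sub>R id_blinfun))
                         (mart_sum X Y n \<omega>))"

end

(* Write T = Q_n + rho I, U_n = <M_n, T^{-1} M_n>, and, with T formed from the first n - 1 terms,
   m = <X_n, T^{-1} M_{n-1}>, w = <X_n, T^{-1} X_n>, s = E[Y_n^2 | F_{n-1}]. The Sherman-Morrison formula gives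
   the scalar recursion U_n = U_{n-1} + (2 Y_n m + Y_n^2 w - s m^2) / (1 + s w). In terms of
   sqrt (U_n + rho), the martingale part of the increment is bounded by 1 / sqrt rho (Cauchy-Schwarz)
   and its conditional variance is absorbed by the drift - s m^2, whatever the size of U. Hence
   exp (sqrt rho / 4 * sqrt (U_n + rho) - 1/4 * sum ln (1 + s w)) is a supermartingale. Ville's
   inequality and sum ln (1 + s w) = ln det (I + Q_n / rho) <= 2 gamma (V_n / rho) give
   Z_n <= sqrt rho + (2 gamma + 4 y) / sqrt rho for all n, with probability at least 1 - exp (- y).
   The determinant is that of the Gram matrix: Sylvester's identity on finite parts of the
   orthonormal basis, then Parseval. *)

theory Submission
  imports Defs "Jordan_Normal_Form.Determinant"
begin

(* The matrix library uses the same infix as the inner product. *)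
no_notation scalar_prod (infix "\<bullet>" 70)

section \<open>Coercive operators\<close>

text \<open>Exponentiating \<open>U\<close> itself fails: its martingale increment
  \<open>2 * Y * m\<close> is of order \<open>sqrt U\<close>, hence unbounded, and only the square
  root divides it by \<open>sqrt (U + \<rho>)\<close>. The shift by \<open>\<rho>\<close> keeps that
  divisor away from zero. The factor \<open>sqrt \<rho> / 4\<close> comes from balancing: the drift
  is linear in the factor, the variance term quadratic, and \<open>1 / 4\<close> is the point up to
  which the estimate lets the drift win. The inverse square root is given by a description and the
  determinant by an infinite sum over subsets of a chosen basis, so both must be evaluated before
  any estimate. This happens only at coercive operators and at finite sums of rank one operators;
  inverses and roots come from contractions in the space of operators, with no spectral theorem.
  Measurability of the event is part of the claim. The space of operators need not be separable, so
  everything is reduced to real quadratic forms on a dense sequence. Conditional variances are fixed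
  only almost everywhere, so outcomes where \<open>Q_n + \<rho> I\<close> is not coercive must be
  covered too.\<close>

definition symmetric_op :: "('a::real_inner \<Rightarrow>\<^sub>L 'a) \<Rightarrow> bool" where
  "symmetric_op T \<longleftrightarrow> (\<forall>x y. blinfun_apply T x \<bullet> y = x \<bullet> blinfun_apply T y)"

text \<open>Positivity with a bounded inverse, in a form that survives adding nonnegative multiples
  of rank one operators and that can be tested on a dense sequence.\<close>

definition coercive_op :: "('a::real_inner \<Rightarrow>\<^sub>L 'a) \<Rightarrow> bool" where
  "coercive_op T \<longleftrightarrow> symmetric_op T \<and> (\<exists>c>0. \<forall>x. c * (x \<bullet> x) \<le> x \<bullet> blinfun_apply T x)"

definition op_inverse :: "('a::real_inner \<Rightarrow>\<^sub>L 'a) \<Rightarrow> ('a \<Rightarrow>\<^sub>L 'a)" where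
  "op_inverse T = (SOME R. T o\<^sub>L R = id_blinfun \<and> R o\<^sub>L T = id_blinfun)"

definition inv_form :: "('a::real_inner \<Rightarrow>\<^sub>L 'a) \<Rightarrow> 'a \<Rightarrow> 'a \<Rightarrow> real" where
  "inv_form T u v = u \<bullet> blinfun_apply (op_inverse T) v"

lemma coercive_op_symmetric: "coercive_op T \<Longrightarrow> symmetric_op T"
  by (simp add: coercive_op_def)

lemma symmetric_opD: "symmetric_op T \<Longrightarrow> blinfun_apply T x \<bullet> y = x \<bullet> blinfun_apply T y"
  by (simp add: symmetric_op_def)

lemma coercive_op_pos:
  assumes "coercive_op T"
  shows "0 \<le> x \<bullet> blinfun_apply T x"
proof -
  obtain c where "c > 0" "\<And>x. c * (x \<bullet> x) \<le> x \<bullet> blinfun_apply T x"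
    using assms unfolding coercive_op_def by blast
  then show ?thesis
    by (meson inner_ge_zero less_eq_real_def mult_nonneg_nonneg order_trans)
qed

lemma symmetric_op_plus [intro]: "symmetric_op S \<Longrightarrow> symmetric_op T \<Longrightarrow> symmetric_op (S + T)"
  by (simp add: symmetric_op_def blinfun.bilinear_simps inner_add_left inner_add_right)

lemma symmetric_op_scaleR [intro]: "symmetric_op T \<Longrightarrow> symmetric_op (c *\<^sub>R T)"
  by (simp add: symmetric_op_def blinfun.bilinear_simps)

lemma symmetric_op_id [intro, simp]: "symmetric_op id_blinfun"
  by (simp add: symmetric_op_def)

lemma symmetric_op_rank_one [intro, simp]: "symmetric_op (rank_one x)"
  by (simp add: symmetric_op_def rank_one_apply inner_commute)

lemma rank_one_scaleR: "rank_one (c *\<^sub>R x) = c\<^sup>2 *\<^sub>R rank_one x"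
  by (rule blinfun_eqI) (simp add: rank_one_apply blinfun.bilinear_simps power2_eq_square)

lemma inner_rank_one: "x \<bullet> blinfun_apply (rank_one z) x = (z \<bullet> x)\<^sup>2"
  by (simp add: rank_one_apply inner_commute power2_eq_square)

section \<open>Inversion of coercive operators\<close>

text \<open>Expanding \<open>|x - t T x|^2\<close> gives the factor
  \<open>1 - 2 t c + t^2 C^2\<close>, which is least at \<open>t = c / C^2\<close>. The contraction
  \<open>I - t T\<close> serves twice: for the inverse and for the square root.\<close>

lemma norm_id_minus_coercive_less_1:
  fixes T :: "'a::real_inner \<Rightarrow>\<^sub>L 'a"
  assumes "coercive_op T"
  obtains t where "t > 0" "norm (id_blinfun - t *\<^sub>R T) < 1"
proof -
  obtain c where c: "c > 0" "\<And>x. c * (x \<bullet> x) \<le> x \<bullet> blinfun_apply T x"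
    using assms unfolding coercive_op_def by blast
  \<comment> \<open>Adding \<open>c\<close> to the norm secures \<open>C > 0\<close> and
    \<open>c \<le> C\<close>, so that \<open>q\<close> below is nonnegative.\<close>
  define C where "C = norm T + c"
  have C: "C > 0" "norm T \<le> C" "c \<le> C" using c by (auto simp: C_def add_nonneg_pos)
  define t where "t = c / C\<^sup>2"
  have t: "t > 0" using c C by (simp add: t_def)
  define q where "q = 1 - c\<^sup>2 / C\<^sup>2"
  have q: "0 \<le> q" "q < 1" using c C by (auto simp: q_def divide_simps power_mono)
  have tq: "1 - 2 * t * c + t\<^sup>2 * C\<^sup>2 = q"
    using C by (simp add: t_def q_def field_simps power2_eq_square)
  have "norm (blinfun_apply (id_blinfun - t *\<^sub>R T) x) \<le> sqrt q * norm x" for x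
  proof -
    have "norm (blinfun_apply T x) \<le> C * norm x"
      by (meson C(2) mult_right_mono norm_blinfun norm_ge_zero order_trans)
    then have Tx: "(norm (blinfun_apply T x))\<^sup>2 \<le> C\<^sup>2 * (x \<bullet> x)"
      by (metis norm_ge_zero power2_norm_eq_inner power_mono power_mult_distrib)
    have "(norm (blinfun_apply (id_blinfun - t *\<^sub>R T) x))\<^sup>2
        = x \<bullet> x - 2 * t * (x \<bullet> blinfun_apply T x) + t\<^sup>2 * (norm (blinfun_apply T x))\<^sup>2"
      unfolding power2_norm_eq_inner
      by (simp add: blinfun.bilinear_simps inner_diff_left inner_diff_right
          inner_commute power2_eq_square algebra_simps)
    also have "\<dots> \<le> x \<bullet> x - 2 * t * (c * (x \<bullet> x)) + t\<^sup>2 * (C\<^sup>2 * (x \<bullet> x))"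
      using c(2)[of x] Tx t by (intro add_mono diff_mono mult_left_mono) auto
    also have "\<dots> = q * (x \<bullet> x)"
      unfolding tq[symmetric] by (simp add: algebra_simps)
    finally have "(norm (blinfun_apply (id_blinfun - t *\<^sub>R T) x))\<^sup>2 \<le> (sqrt q * norm x)\<^sup>2"
      using q by (simp add: power_mult_distrib power2_norm_eq_inner)
    then show ?thesis
      using q by (simp add: power2_le_iff_abs_le)
  qed
  then have "norm (id_blinfun - t *\<^sub>R T) \<le> sqrt q"
    using q by (intro norm_blinfun_bound) auto
  also have "\<dots> < 1" using q by simp
  finally show thesis using that t by blast
qed

text \<open>Richardson iteration for \<open>T R = I\<close> is a contraction of the Banach space of
  operators, and its fixed point is a right inverse. Coercivity makes \<open>T\<close> injective,
  which turns it into a two-sided inverse.\<close>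

lemma coercive_op_invertible:
  fixes T :: "'a::{real_inner,banach} \<Rightarrow>\<^sub>L 'a"
  assumes T: "coercive_op T"
  shows "\<exists>R. T o\<^sub>L R = id_blinfun \<and> R o\<^sub>L T = id_blinfun"
proof -
  obtain t where t: "t > 0" "norm (id_blinfun - t *\<^sub>R T) < 1"
    using norm_id_minus_coercive_less_1[OF T] .
  define f where "f R = R - t *\<^sub>R ((T o\<^sub>L R) - id_blinfun)" for R
  have "dist (f R) (f R') \<le> norm (id_blinfun - t *\<^sub>R T) * dist R R'" for R R'
  proof -
    have "f R - f R' = (id_blinfun - t *\<^sub>R T) o\<^sub>L (R - R')"
      by (rule blinfun_eqI) (simp add: f_def blinfun.bilinear_simps algebra_simps)
    then show ?thesis
      by (metis dist_norm norm_blinfun_compose)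
  qed
  then have "\<exists>!R. f R = R"
    using t by (intro banach_fix_type[of "norm (id_blinfun - t *\<^sub>R T)"]) auto
  then obtain R where "f R = R" by blast
  then have TR: "T o\<^sub>L R = id_blinfun" using t by (simp add: f_def)
  have inj: "x = 0" if "blinfun_apply T x = 0" for x
  proof -
    obtain c where "c > 0" "c * (x \<bullet> x) \<le> x \<bullet> blinfun_apply T x"
      using T unfolding coercive_op_def by blast
    then have "x \<bullet> x \<le> 0" using that by (simp add: mult_le_0_iff)
    then show ?thesis by (metis inner_ge_zero inner_eq_zero_iff order_antisym)
  qed
  have "R o\<^sub>L T = id_blinfun"
  proof (rule blinfun_eqI)
    fix x
    have "blinfun_apply T (blinfun_apply R (blinfun_apply T x) - x)
        = blinfun_apply (T o\<^sub>L R) (blinfun_apply T x) - blinfun_apply T x"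
      by (simp add: blinfun.bilinear_simps)
    also have "\<dots> = 0" by (simp add: TR)
    finally show "blinfun_apply (R o\<^sub>L T) x = blinfun_apply id_blinfun x"
      using inj by force
  qed
  with TR show ?thesis by blast
qed

lemma
  fixes T :: "'a::{real_inner,banach} \<Rightarrow>\<^sub>L 'a"
  assumes T: "coercive_op T"
  shows op_inverse_right: "blinfun_apply T (blinfun_apply (op_inverse T) x) = x"
    and op_inverse_left: "blinfun_apply (op_inverse T) (blinfun_apply T x) = x"
proof -
  have "T o\<^sub>L op_inverse T = id_blinfun \<and> op_inverse T o\<^sub>L T = id_blinfun"
    unfolding op_inverse_def by (rule someI_ex) (rule coercive_op_invertible[OF T])
  then show "blinfun_apply T (blinfun_apply (op_inverse T) x) = x"
    "blinfun_apply (op_inverse T) (blinfun_apply T x) = x"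
    by (metis blinfun_apply_blinfun_compose blinfun_apply_id_blinfun)+
qed

lemma op_inverse_eqI:
  fixes T :: "'a::{real_inner,banach} \<Rightarrow>\<^sub>L 'a"
  assumes "coercive_op T" "\<And>x. blinfun_apply T (blinfun_apply R x) = x"
  shows "op_inverse T = R"
  by (rule blinfun_eqI) (metis assms op_inverse_left)

text \<open>For \<open>u = T v\<close> the form \<open><u, T^{-1} u> = <v, T v>\<close> is at least
  \<open>c |v|^2\<close>, while \<open>|u|\<close> is at most \<open>(norm T + 1) |v|\<close>. The
  added 1 keeps the denominator positive.\<close>

lemma coercive_op_inverse:
  fixes T :: "'a::{real_inner,banach} \<Rightarrow>\<^sub>L 'a"
  assumes T: "coercive_op T"
  shows "coercive_op (op_inverse T)"
proof -
  let ?R = "op_inverse T"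
  note TR = op_inverse_right[OF T] and sym = symmetric_opD[OF coercive_op_symmetric[OF T]]
  obtain c where c: "c > 0" "\<And>x. c * (x \<bullet> x) \<le> x \<bullet> blinfun_apply T x"
    using T unfolding coercive_op_def by blast
  have "symmetric_op ?R"
    unfolding symmetric_op_def by (metis TR sym)
  moreover have "c / (norm T + 1)\<^sup>2 * (u \<bullet> u) \<le> u \<bullet> blinfun_apply ?R u" for u
  proof -
    let ?v = "blinfun_apply ?R u"
    have "norm u \<le> (norm T + 1) * norm ?v"
      using norm_blinfun[of T ?v] by (simp add: TR algebra_simps add_increasing)
    then have "u \<bullet> u \<le> (norm T + 1)\<^sup>2 * (?v \<bullet> ?v)"
      by (metis norm_ge_zero power2_norm_eq_inner power_mono power_mult_distrib)
    then have "c / (norm T + 1)\<^sup>2 * (u \<bullet> u) \<le> c / (norm T + 1)\<^sup>2 * ((norm T + 1)\<^sup>2 * (?v \<bullet> ?v))"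
      using c by (intro mult_left_mono) auto
    also have "\<dots> = c * (?v \<bullet> ?v)"
      using norm_ge_zero[of T] by (simp add: add_nonneg_eq_0_iff)
    also have "\<dots> \<le> ?v \<bullet> blinfun_apply T ?v" by (rule c)
    finally show ?thesis by (simp add: TR inner_commute)
  qed
  moreover have "c / (norm T + 1)\<^sup>2 > 0"
    using c by (intro divide_pos_pos zero_less_power) (auto simp: add_nonneg_pos)
  ultimately show ?thesis
    unfolding coercive_op_def by blast
qed

lemma coercive_op_plus_rank_one:
  assumes "coercive_op T" "0 \<le> s"
  shows "coercive_op (T + s *\<^sub>R rank_one x)"
proof -
  obtain c where "c > 0" "\<And>u. c * (u \<bullet> u) \<le> u \<bullet> blinfun_apply T u"
    using assms(1) unfolding coercive_op_def by blast
  moreover have "u \<bullet> blinfun_apply T u \<le> u \<bullet> blinfun_apply (T + s *\<^sub>R rank_one x) u" for u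
    using assms(2) by (simp add: blinfun.bilinear_simps inner_add_right inner_rank_one)
  ultimately have "c > 0 \<and> (\<forall>u. c * (u \<bullet> u) \<le> u \<bullet> blinfun_apply (T + s *\<^sub>R rank_one x) u)"
    by (meson order_trans)
  then show ?thesis
    using assms(1) unfolding coercive_op_def by blast
qed

lemma coercive_op_scaleR_id: "c > 0 \<Longrightarrow> coercive_op (c *\<^sub>R id_blinfun)"
  unfolding coercive_op_def by (auto simp: blinfun.bilinear_simps intro!: exI[of _ c])

section \<open>The bilinear form of the inverse\<close>

lemma inv_form_commute:
  fixes T :: "'a::{real_inner,banach} \<Rightarrow>\<^sub>L 'a"
  assumes "coercive_op T"
  shows "inv_form T u v = inv_form T v u"
  using symmetric_opD[OF coercive_op_symmetric[OF coercive_op_inverse[OF assms]]]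
  by (simp add: inv_form_def inner_commute)

lemma inv_form_nonneg:
  fixes T :: "'a::{real_inner,banach} \<Rightarrow>\<^sub>L 'a"
  assumes "coercive_op T"
  shows "0 \<le> inv_form T u u"
  by (simp add: inv_form_def coercive_op_pos[OF coercive_op_inverse[OF assms]])

lemma inv_form_polarization:
  fixes T :: "'a::{real_inner,banach} \<Rightarrow>\<^sub>L 'a"
  assumes "coercive_op T"
  shows "inv_form T u v = (inv_form T (u + v) (u + v) - inv_form T (u - v) (u - v)) / 4"
  using inv_form_commute[OF assms, of u v]
  by (simp add: inv_form_def blinfun.bilinear_simps inner_add_left inner_add_right
      inner_diff_left inner_diff_right)

lemma inv_form_Cauchy_Schwarz:
  fixes T :: "'a::{real_inner,banach} \<Rightarrow>\<^sub>L 'a"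
  assumes T: "coercive_op T"
  shows "(inv_form T u v)\<^sup>2 \<le> inv_form T u u * inv_form T v v"
proof -
  have lin: "inv_form T (u - t *\<^sub>R v) (u - t *\<^sub>R v)
      = inv_form T u u - 2 * t * inv_form T u v + t\<^sup>2 * inv_form T v v" for t
    using inv_form_commute[OF T, of u v]
    by (simp add: inv_form_def blinfun.bilinear_simps inner_diff_left inner_diff_right
        power2_eq_square algebra_simps)
  have pos: "0 \<le> inv_form T u u - 2 * t * inv_form T u v + t\<^sup>2 * inv_form T v v" for t
    using inv_form_nonneg[OF T, of "u - t *\<^sub>R v"] by (simp add: lin)
  show ?thesis
  proof (cases "inv_form T v v = 0")
    case True
    have "inv_form T u v = 0"
    proof (rule ccontr)
      assume "inv_form T u v \<noteq> 0"
      \<comment> \<open>The quadratic term vanishes here, and this \<open>t\<close> would give the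
        remaining linear polynomial the value -1.\<close>
      with pos[of "(inv_form T u u + 1) / (2 * inv_form T u v)"] True show False by simp
    qed
    with True show ?thesis by simp
  next
    case False
    with inv_form_nonneg[OF T, of v] have "inv_form T v v > 0" by simp
    with pos[of "inv_form T u v / inv_form T v v"] show ?thesis
      by (simp add: power2_eq_square field_simps)
  qed
qed

text \<open>Expand \<open>(1 / c) |u - c v|^2 \<ge> 0\<close> at \<open>v = T^{-1} u\<close>. With
  \<open>c = \<rho>\<close> this bounds \<open>w\<close> by \<open>1 / \<rho>\<close> and, for each
  \<open>n\<close>, bounds \<open>U n\<close>.\<close>

lemma inv_form_le:
  fixes T :: "'a::{real_inner,banach} \<Rightarrow>\<^sub>L 'a"
  assumes T: "coercive_op T" and c: "c > 0" "\<And>x. c * (x \<bullet> x) \<le> x \<bullet> blinfun_apply T x"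
  shows "inv_form T u u \<le> (u \<bullet> u) / c"
proof -
  let ?v = "blinfun_apply (op_inverse T) u"
  have "0 \<le> (1 / c) * ((u - c *\<^sub>R ?v) \<bullet> (u - c *\<^sub>R ?v))" using c by simp
  also have "\<dots> = (u \<bullet> u) / c - 2 * (u \<bullet> ?v) + c * (?v \<bullet> ?v)"
    using c by (simp add: inner_diff_left inner_diff_right inner_commute field_simps)
  also have "\<dots> \<le> (u \<bullet> u) / c - 2 * (u \<bullet> ?v) + ?v \<bullet> blinfun_apply T ?v"
    using c(2)[of ?v] by simp
  finally show ?thesis
    by (simp add: inv_form_def op_inverse_right[OF T] inner_commute)
qed

text \<open>The inverse form is the maximum over \<open>x\<close> of
  \<open>2 <x, u> - <x, T x>\<close>, attained at \<open>x = T^{-1} u\<close>; the deficit is the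
  form of \<open>T\<close> at \<open>x - T^{-1} u\<close>. Measurability of the inverse form rests
  on this.\<close>

lemma inv_form_variational:
  fixes T :: "'a::{real_inner,banach} \<Rightarrow>\<^sub>L 'a"
  assumes T: "coercive_op T"
  shows "2 * (x \<bullet> u) - x \<bullet> blinfun_apply T x \<le> inv_form T u u"
    and "2 * (blinfun_apply (op_inverse T) u \<bullet> u)
      - blinfun_apply (op_inverse T) u \<bullet> blinfun_apply T (blinfun_apply (op_inverse T) u) = inv_form T u u"
proof -
  let ?v = "blinfun_apply (op_inverse T) u"
  have "0 \<le> (x - ?v) \<bullet> blinfun_apply T (x - ?v)" by (rule coercive_op_pos[OF T])
  also have "\<dots> = x \<bullet> blinfun_apply T x - 2 * (x \<bullet> u) + inv_form T u u"
    using symmetric_opD[OF coercive_op_symmetric[OF T], of ?v x]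
    by (simp add: inv_form_def blinfun.bilinear_simps inner_diff_left inner_diff_right
        op_inverse_right[OF T] inner_commute)
  finally show "2 * (x \<bullet> u) - x \<bullet> blinfun_apply T x \<le> inv_form T u u" by simp
  show "2 * (?v \<bullet> u) - ?v \<bullet> blinfun_apply T ?v = inv_form T u u"
    by (simp add: inv_form_def op_inverse_right[OF T] inner_commute)
qed

lemma op_inverse_plus_rank_one:
  fixes T :: "'a::{real_inner,banach} \<Rightarrow>\<^sub>L 'a"
  assumes T: "coercive_op T" and s: "0 \<le> s"
  shows "op_inverse (T + s *\<^sub>R rank_one x)
    = op_inverse T - (s / (1 + s * inv_form T x x)) *\<^sub>R rank_one (blinfun_apply (op_inverse T) x)"
proof (rule op_inverse_eqI[OF coercive_op_plus_rank_one[OF T s]])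
  fix u
  let ?v = "blinfun_apply (op_inverse T) x" and ?k = "s / (1 + s * inv_form T x x)"
  have "1 + s * inv_form T x x > 0"
    using inv_form_nonneg[OF T, of x] s by (simp add: add_pos_nonneg)
  \<comment> \<open>This is the total coefficient of \<open>x\<close> when the product of the two
    operators is expanded, up to the factor \<open><T^{-1} x, u>\<close>; the choice of
    \<open>?k\<close> makes it vanish.\<close>
  then have k: "s - ?k * (1 + s * inv_form T x x) = 0" by simp
  have xu: "x \<bullet> blinfun_apply (op_inverse T) u = ?v \<bullet> u"
    using inv_form_commute[OF T, of x u] by (simp add: inv_form_def inner_commute)
  have "blinfun_apply (T + s *\<^sub>R rank_one x) (blinfun_apply (op_inverse T - ?k *\<^sub>R rank_one ?v) u)
      = u + ((?v \<bullet> u) * (s - ?k * (1 + s * inv_form T x x))) *\<^sub>R x"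
    unfolding inv_form_def ring_distribs right_diff_distrib scaleR_add_left scaleR_diff_left
    by (simp add: blinfun.bilinear_simps rank_one_apply op_inverse_right[OF T] inner_diff_right xu
        scaleR_add_left scaleR_diff_left mult_ac add_ac scaleR_add_right)
  then show "blinfun_apply (T + s *\<^sub>R rank_one x) (blinfun_apply (op_inverse T - ?k *\<^sub>R rank_one ?v) u) = u"
    unfolding k by simp
qed

lemma inv_form_plus_rank_one:
  fixes T :: "'a::{real_inner,banach} \<Rightarrow>\<^sub>L 'a"
  assumes T: "coercive_op T" and s: "0 \<le> s"
  shows "inv_form (T + s *\<^sub>R rank_one x) u v
    = inv_form T u v - s * inv_form T u x * inv_form T x v / (1 + s * inv_form T x x)"
  using symmetric_opD[OF coercive_op_symmetric[OF coercive_op_inverse[OF T]], of x v]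
  by (simp add: inv_form_def[of "T + s *\<^sub>R rank_one x"] op_inverse_plus_rank_one[OF T s] blinfun.bilinear_simps
      rank_one_apply inner_diff_right inv_form_def[of T _ "_::'a"] divide_simps algebra_simps)

section \<open>Positive square roots\<close>

lemma closed_symmetric_op: "closed {R :: 'a::real_inner \<Rightarrow>\<^sub>L 'a. symmetric_op R}"
  unfolding symmetric_op_def
  by (intro closed_Collect_all closed_Collect_eq continuous_intros)

text \<open>This is \<open>S^2 \<le> C S\<close>, obtained without a root of \<open>S\<close>:
  positivity of \<open>S\<close> at the vector \<open>v - S v / C\<close> suffices. It makes
  \<open>I - S / C\<close> a contraction in the uniqueness proof.\<close>

lemma positive_op_norm_sq_le:
  fixes S :: "'a::real_inner \<Rightarrow>\<^sub>L 'a"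
  assumes S: "positive_op S" and C: "C > 0" "norm S \<le> C"
  shows "blinfun_apply S v \<bullet> blinfun_apply S v \<le> C * (v \<bullet> blinfun_apply S v)"
proof -
  let ?w = "v - (1 / C) *\<^sub>R blinfun_apply S v" and ?n = "blinfun_apply S v \<bullet> blinfun_apply S v"
  have sym: "blinfun_apply S x \<bullet> y = x \<bullet> blinfun_apply S y" for x y
    using S by (simp add: positive_op_def)
  have "norm (blinfun_apply S (blinfun_apply S v)) \<le> C * norm (blinfun_apply S v)"
    by (meson C(2) mult_right_mono norm_blinfun norm_ge_zero order_trans)
  then have "blinfun_apply S v \<bullet> blinfun_apply S (blinfun_apply S v)
      \<le> norm (blinfun_apply S v) * (C * norm (blinfun_apply S v))"
    by (meson mult_left_mono norm_cauchy_schwarz norm_ge_zero order_trans)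
  also have "\<dots> = C * ?n" by (simp add: dot_square_norm power2_eq_square)
  finally have SSS: "blinfun_apply S v \<bullet> blinfun_apply S (blinfun_apply S v) \<le> C * ?n" .
  have "0 \<le> C * (?w \<bullet> blinfun_apply S ?w)"
    using S C by (simp add: positive_op_def)
  also have "\<dots> = C * (v \<bullet> blinfun_apply S v) - 2 * ?n
      + (blinfun_apply S v \<bullet> blinfun_apply S (blinfun_apply S v)) / C"
    using C by (simp add: blinfun.bilinear_simps inner_diff_left inner_diff_right sym[of v "blinfun_apply S v"] sym field_simps)
  also have "\<dots> \<le> C * (v \<bullet> blinfun_apply S v) - ?n"
    using SSS C by (simp add: field_simps)
  finally show ?thesis by simp
qed

text \<open>With \<open>D = S - R\<close> the equation \<open>S\<^sup>2 = R\<^sup>2\<close> reads \<open>R D = - D S\<close>, so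
  \<open>(I + R / C) D = D (I - S / C)\<close>, where \<open>I - S / C\<close> is a contraction and \<open>I + R / C\<close> expands.\<close>

lemma positive_sqrt_unique:
  fixes S R A :: "'a::real_inner \<Rightarrow>\<^sub>L 'a"
  assumes S: "positive_op S" "S o\<^sub>L S = A" and R: "positive_op R" "R o\<^sub>L R = A"
    and c: "c > 0" "\<And>x. c * (x \<bullet> x) \<le> x \<bullet> blinfun_apply A x"
  shows "S = R"
proof -
  define C where "C = norm S + 1"
  have C: "C > 0" "norm S \<le> C" by (auto simp: C_def add_nonneg_pos)
  define D where "D = S - R"
  define E where "E = id_blinfun - (1 / C) *\<^sub>R S"
  define G where "G = id_blinfun + (1 / C) *\<^sub>R R"
  \<comment> \<open>The expansion factor of \<open>G\<close>: dropping the nonnegative cross term,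
    \<open>|G x|^2\<close> is at least \<open>|x|^2 + <x, A x> / C^2\<close>. Coercivity of
    \<open>A\<close> is what makes it strictly larger than 1.\<close>
  define k where "k = sqrt (1 + c / C\<^sup>2)"
  have k: "k > 1" using c C by (simp add: k_def)
  have E: "norm (blinfun_apply E x) \<le> norm x" for x
  proof -
    have "blinfun_apply E x \<bullet> blinfun_apply E x
        = x \<bullet> x - 2 / C * (x \<bullet> blinfun_apply S x) + (blinfun_apply S x \<bullet> blinfun_apply S x) / C\<^sup>2"
      by (simp add: E_def blinfun.bilinear_simps inner_diff_left inner_diff_right inner_commute
          power2_eq_square)
    also have "\<dots> \<le> x \<bullet> x - 2 / C * (x \<bullet> blinfun_apply S x) + (C * (x \<bullet> blinfun_apply S x)) / C\<^sup>2"
      by (intro add_left_mono divide_right_mono positive_op_norm_sq_le S C) auto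
    also have "\<dots> = x \<bullet> x - (x \<bullet> blinfun_apply S x) / C"
      using C by (simp add: power2_eq_square)
    also have "\<dots> \<le> x \<bullet> x"
      using S C by (simp add: positive_op_def)
    finally show ?thesis by (simp add: norm_le)
  qed
  have G: "k * norm x \<le> norm (blinfun_apply G x)" for x
  proof -
    have "(k * norm x)\<^sup>2 = x \<bullet> x + c * (x \<bullet> x) / C\<^sup>2"
      using c by (simp add: k_def power_mult_distrib dot_square_norm ring_distribs add_nonneg_nonneg)
    also have "\<dots> \<le> x \<bullet> x + (x \<bullet> blinfun_apply A x) / C\<^sup>2"
      using c(2)[of x] by (simp add: divide_right_mono)
    also have "x \<bullet> blinfun_apply A x = blinfun_apply R x \<bullet> blinfun_apply R x"
      using R by (auto simp: positive_op_def)
    also have "x \<bullet> x + (blinfun_apply R x \<bullet> blinfun_apply R x) / C\<^sup>2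
        \<le> x \<bullet> x + 2 / C * (x \<bullet> blinfun_apply R x) + (blinfun_apply R x \<bullet> blinfun_apply R x) / C\<^sup>2"
      using R C by (simp add: positive_op_def)
    also have "\<dots> = blinfun_apply G x \<bullet> blinfun_apply G x"
      by (simp add: G_def blinfun.bilinear_simps inner_add_left inner_add_right inner_commute
          power2_eq_square)
    also have "\<dots> = (norm (blinfun_apply G x))\<^sup>2" by (rule dot_square_norm)
    finally show ?thesis by (rule power2_le_imp_le) simp
  qed
  have GD: "G o\<^sub>L D = D o\<^sub>L E"
  proof (rule blinfun_eqI)
    fix x
    have "blinfun_apply S (blinfun_apply S x) = blinfun_apply R (blinfun_apply R x)"
      using S R by (metis blinfun_apply_blinfun_compose)
    then show "blinfun_apply (G o\<^sub>L D) x = blinfun_apply (D o\<^sub>L E) x"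
      by (simp add: G_def D_def E_def blinfun.bilinear_simps algebra_simps)
  qed
  have "norm D \<le> norm D / k"
  proof (rule norm_blinfun_bound)
    fix x
    have "k * norm (blinfun_apply D x) \<le> norm (blinfun_apply G (blinfun_apply D x))" by (rule G)
    also have "\<dots> = norm (blinfun_apply D (blinfun_apply E x))"
      using GD by (metis blinfun_apply_blinfun_compose)
    also have "\<dots> \<le> norm D * norm (blinfun_apply E x)" by (rule norm_blinfun)
    also have "\<dots> \<le> norm D * norm x" by (intro mult_left_mono E) auto
    finally show "norm (blinfun_apply D x) \<le> norm D / k * norm x"
      using k by (simp add: field_simps)
  qed (use k in auto)
  then have "norm D = 0"
    using k by (simp add: pos_le_divide_eq mult_le_cancel_left1 mult_le_cancel_left2)
  then show "S = R" by (simp add: D_def)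
qed

text \<open>If \<open>t A = I - K\<close> with \<open>\<parallel>K\<parallel> < 1\<close>, then \<open>R \<mapsto> (K + R\<^sup>2) / 2\<close> is a contraction of a ball of radius
  less than one, and its fixed point satisfies \<open>(I - R)\<^sup>2 = I - K\<close>.\<close>

lemma positive_sqrt_exists:
  fixes A :: "'a::{real_inner,banach} \<Rightarrow>\<^sub>L 'a"
  assumes A: "coercive_op A"
  shows "\<exists>S. positive_op S \<and> S o\<^sub>L S = A"
proof -
  obtain t where t: "t > 0" "norm (id_blinfun - t *\<^sub>R A) < 1"
    using norm_id_minus_coercive_less_1[OF A] .
  define K where "K = id_blinfun - t *\<^sub>R A"
  have symK: "symmetric_op K"
  proof -
    have "K = id_blinfun + (- t) *\<^sub>R A" by (simp add: K_def)
    then show ?thesis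
      using A by (metis coercive_op_symmetric symmetric_op_id symmetric_op_plus symmetric_op_scaleR)
  qed
  \<comment> \<open>The smaller root of \<open>(norm K + r^2) / 2 = r\<close>: the ball of radius
    \<open>r\<close> is mapped into itself, and \<open>r < 1\<close> is also the Lipschitz constant
    of \<open>f\<close> there. Restricting to symmetric operators makes the fixed point
    symmetric.\<close>
  define r where "r = 1 - sqrt (1 - norm K)"
  have r: "0 \<le> r" "r < 1" using t by (auto simp: r_def K_def)
  have "(1 - r)\<^sup>2 = 1 - norm K" using t by (simp add: r_def K_def)
  then have rr: "(norm K + r\<^sup>2) / 2 = r" by (simp add: power2_eq_square algebra_simps)
  define f where "f R = (1 / 2) *\<^sub>R (K + (R o\<^sub>L R))" for R
  define s where "s = {R :: 'a \<Rightarrow>\<^sub>L 'a. symmetric_op R} \<inter> cball 0 r"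
  have "closed s"
    unfolding s_def by (intro closed_Int closed_symmetric_op closed_cball)
  then have "\<exists>!R. R \<in> s \<and> f R = R"
  proof (rule Banach_fix[OF complete_eq_closed[THEN iffD2]])
    have "0 \<in> s" using r by (simp add: s_def symmetric_op_def)
    then show "s \<noteq> {}" by blast
    show "0 \<le> r" "r < 1" using r by auto
    show "f ` s \<subseteq> s"
    proof
      fix R' assume "R' \<in> f ` s"
      then obtain R where R: "R' = f R" "symmetric_op R" "norm R \<le> r"
        by (auto simp: s_def)
      have "norm R * norm R \<le> r * r"
        using R r by (intro mult_mono) auto
      then have "norm (K + (R o\<^sub>L R)) \<le> norm K + r\<^sup>2"
        by (metis (no_types, lifting) add_left_mono norm_blinfun_compose norm_triangle_ineq order_trans power2_eq_square)
      then have "norm R' \<le> r"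
        using rr by (simp add: R f_def)
      moreover have "symmetric_op (R o\<^sub>L R)"
        using R by (simp add: symmetric_op_def)
      then have "symmetric_op R'"
        unfolding R f_def using symK by blast
      ultimately show "R' \<in> s" by (simp add: s_def)
    qed
    show "dist (f R) (f R') \<le> r * dist R R'" if "R \<in> s" "R' \<in> s" for R R'
    proof -
      have "f R - f R' = (1 / 2) *\<^sub>R ((R o\<^sub>L (R - R')) + ((R - R') o\<^sub>L R'))"
        by (rule blinfun_eqI) (simp add: f_def blinfun.bilinear_simps algebra_simps)
      then have "norm (f R - f R') \<le> (1 / 2) * (norm R * norm (R - R') + norm (R - R') * norm R')"
        using norm_triangle_ineq[of "R o\<^sub>L (R - R')" "(R - R') o\<^sub>L R'"]
          norm_blinfun_compose[of R "R - R'"] norm_blinfun_compose[of "R - R'" R'] by simp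
      also have "\<dots> \<le> (1 / 2) * (r * norm (R - R') + norm (R - R') * r)"
        using that by (intro mult_left_mono add_mono mult_right_mono mult_left_mono) (auto simp: s_def)
      finally show ?thesis by (simp add: dist_norm mult.commute)
    qed
  qed
  then obtain R where R: "symmetric_op R" "norm R \<le> r" "f R = R"
    by (auto simp: s_def)
  define B where "B = id_blinfun - R"
  \<comment> \<open>The fixed point equation says \<open>B^2 = t A\<close>; the factor removes
    \<open>t\<close>.\<close>
  define S where "S = (1 / sqrt t) *\<^sub>R B"
  have "S o\<^sub>L S = A"
  proof (rule blinfun_eqI)
    fix x
    have "blinfun_apply (f R + f R) x = blinfun_apply R x + blinfun_apply R x"
      by (simp add: R blinfun.bilinear_simps)
    then have "blinfun_apply R (blinfun_apply R x) + blinfun_apply K x = blinfun_apply R x + blinfun_apply R x"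
      by (simp add: f_def blinfun.bilinear_simps add.commute flip: scaleR_add_left)
    then have "blinfun_apply B (blinfun_apply B x) = t *\<^sub>R blinfun_apply A x"
      by (simp add: B_def K_def blinfun.bilinear_simps algebra_simps)
    then show "blinfun_apply (S o\<^sub>L S) x = blinfun_apply A x"
      using t by (simp add: S_def blinfun.bilinear_simps)
  qed
  moreover have "0 \<le> x \<bullet> blinfun_apply B x" for x
  proof -
    have "x \<bullet> blinfun_apply R x \<le> norm x * (norm R * norm x)"
      by (meson mult_left_mono norm_blinfun norm_cauchy_schwarz norm_ge_zero order_trans)
    also have "\<dots> \<le> norm x * (1 * norm x)"
      using R r by (intro mult_left_mono mult_right_mono) auto
    finally show ?thesis
      by (simp add: B_def blinfun.bilinear_simps inner_diff_right dot_square_norm power2_eq_square)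
  qed
  then have "positive_op S"
    using R t by (simp add: positive_op_def S_def B_def symmetric_op_def blinfun.bilinear_simps
        inner_diff_left inner_diff_right)
  ultimately show ?thesis by blast
qed

text \<open>The description in \<open>inv_sqrt_op\<close> is resolved here: the positive root of
  \<open>T^{-1}\<close> meets it, and any other candidate squares to \<open>T^{-1}\<close> as well,
  so uniqueness of positive roots applies. Afterwards only \<open>inv_form\<close> occurs.\<close>

lemma norm_inv_sqrt_op:
  fixes T :: "'a::{real_inner,banach} \<Rightarrow>\<^sub>L 'a"
  assumes T: "coercive_op T"
  shows "norm (blinfun_apply (inv_sqrt_op T) u) = sqrt (inv_form T u u)"
proof -
  let ?R = "op_inverse T"
  have R: "coercive_op ?R" by (rule coercive_op_inverse[OF T])
  obtain S where S: "positive_op S" "S o\<^sub>L S = ?R"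
    using positive_sqrt_exists[OF R] by blast
  obtain c where c: "c > 0" "\<And>x. c * (x \<bullet> x) \<le> x \<bullet> blinfun_apply ?R x"
    using R unfolding coercive_op_def by blast
  have "inv_sqrt_op T = S"
    unfolding inv_sqrt_op_def
  proof (rule the_equality)
    have "?R o\<^sub>L T = id_blinfun" "T o\<^sub>L ?R = id_blinfun"
      by (auto intro!: blinfun_eqI simp: op_inverse_left[OF T] op_inverse_right[OF T])
    then show "positive_op S \<and> (S o\<^sub>L S) o\<^sub>L T = id_blinfun \<and> T o\<^sub>L (S o\<^sub>L S) = id_blinfun"
      using S by simp
  next
    fix S' assume S': "positive_op S' \<and> (S' o\<^sub>L S') o\<^sub>L T = id_blinfun \<and> T o\<^sub>L (S' o\<^sub>L S') = id_blinfun"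
    have "?R = S' o\<^sub>L S'"
      using S' by (intro op_inverse_eqI[OF T]) (metis blinfun_apply_blinfun_compose blinfun_apply_id_blinfun)
    with S' S c show "S' = S"
      by (intro positive_sqrt_unique[of S' ?R S c]) auto
  qed
  moreover have "blinfun_apply S u \<bullet> blinfun_apply S u = inv_form T u u"
    using S by (auto simp: positive_op_def inv_form_def simp flip: S(2))
  ultimately show ?thesis by (simp add: norm_eq_sqrt_inner)
qed

text \<open>Outside the coercive operators the description in the definition of the inverse square root
  is empty, so that the junk value does not depend on \<open>T\<close>.\<close>

lemma inv_sqrt_op_not_coercive:
  fixes T :: "'a::real_inner \<Rightarrow>\<^sub>L 'a"
  assumes T: "symmetric_op T" "\<not> coercive_op T"
  shows "inv_sqrt_op T = (THE S. False)"
proof -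
  have False if S: "positive_op S" "(S o\<^sub>L S) o\<^sub>L T = id_blinfun" for S
  proof -
    have "1 / (norm S + 1)\<^sup>2 * (x \<bullet> x) \<le> x \<bullet> blinfun_apply T x" for x
    proof -
      \<comment> \<open>A candidate \<open>S\<close> would force coercivity:
        \<open>x = S ?u\<close>, and \<open>|?u|^2 = <x, T x>\<close> because \<open>S\<close> is
        symmetric.\<close>
      let ?u = "blinfun_apply S (blinfun_apply T x)"
      have x: "x = blinfun_apply S ?u"
        using S(2) by (metis blinfun_apply_blinfun_compose blinfun_apply_id_blinfun)
      have "norm x \<le> norm S * norm ?u"
        by (metis x norm_blinfun)
      also have "\<dots> \<le> (norm S + 1) * norm ?u" by (intro mult_right_mono) auto
      finally have "x \<bullet> x \<le> (norm S + 1)\<^sup>2 * (?u \<bullet> ?u)"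
        by (metis norm_ge_zero power2_norm_eq_inner power_mono power_mult_distrib)
      also have "?u \<bullet> ?u = x \<bullet> blinfun_apply T x"
        using S(1) x by (metis positive_op_def)
      finally show ?thesis
        using norm_ge_zero[of S] by (simp add: divide_le_eq mult.commute add_nonneg_eq_0_iff)
    qed
    moreover have "1 / (norm S + 1)\<^sup>2 > 0"
      by (intro divide_pos_pos zero_less_power) (auto simp: add_nonneg_pos)
    ultimately show False
      using T unfolding coercive_op_def by blast
  qed
  then show ?thesis
    unfolding inv_sqrt_op_def by (metis (no_types))
qed

section \<open>Orthonormal bases\<close>

definition orthonormal :: "'a::real_inner set \<Rightarrow> bool" where
  "orthonormal E \<longleftrightarrow> (\<forall>e\<in>E. norm e = 1) \<and> (\<forall>e\<in>E. \<forall>f\<in>E. e \<noteq> f \<longrightarrow> e \<bullet> f = 0)"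

lemma orthonormal_basis_iff: "orthonormal_basis E \<longleftrightarrow> orthonormal E \<and> closure (span E) = UNIV"
  by (simp add: orthonormal_basis_def orthonormal_def)

lemma orthonormal_subset: "orthonormal E \<Longrightarrow> F \<subseteq> E \<Longrightarrow> orthonormal F"
  by (auto simp: orthonormal_def)

lemma orthonormal_inner:
  "orthonormal E \<Longrightarrow> e \<in> E \<Longrightarrow> f \<in> E \<Longrightarrow> e \<bullet> f = (if e = f then 1 else 0)"
  by (auto simp: orthonormal_def dot_square_norm)

lemma orthonormal_sum_inner:
  assumes "orthonormal F" "finite F" "f \<in> F"
  shows "(\<Sum>e\<in>F. (x \<bullet> e) *\<^sub>R e) \<bullet> f = x \<bullet> f"
proof -
  have "(\<Sum>e\<in>F. (x \<bullet> e) *\<^sub>R e) \<bullet> f = (\<Sum>e\<in>F. if e = f then x \<bullet> e else 0)"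
    unfolding inner_sum_left by (rule sum.cong) (use assms in \<open>auto simp: orthonormal_inner\<close>)
  also have "\<dots> = x \<bullet> f" using assms by simp
  finally show ?thesis .
qed

lemma orthonormal_best_approximation:
  assumes F: "orthonormal F" "finite F" and v: "v \<in> span F"
  shows "norm (x - (\<Sum>e\<in>F. (x \<bullet> e) *\<^sub>R e)) \<le> norm (x - v)"
proof -
  let ?p = "\<Sum>e\<in>F. (x \<bullet> e) *\<^sub>R e"
  have ortho: "(x - ?p) \<bullet> w = 0" if "w \<in> span F" for w
    using that
  proof (rule span_induct)
    show "(x - ?p) \<bullet> f = 0" if "f \<in> F" for f
      using orthonormal_sum_inner[OF F that, of x] by (simp add: inner_diff_left)
  qed (auto simp: subspace_def inner_add_right)
  have "?p - v \<in> span F"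
    by (intro span_diff span_sum span_scale v) (simp add: span_base)
  note ortho = ortho[OF this]
  have "(norm (a + b))\<^sup>2 = (norm a)\<^sup>2 + (norm b)\<^sup>2" if "a \<bullet> b = 0" for a b :: 'a
    using that by (simp add: power2_norm_eq_inner inner_add_left inner_add_right inner_commute)
  from this[OF ortho]
  have "(norm (x - ?p))\<^sup>2 \<le> (norm (x - v))\<^sup>2" by simp
  then show ?thesis by (rule power2_le_imp_le) simp
qed

text \<open>One Gram-Schmidt step; nothing is added when \<open>d\<close> already lies in the
  span.\<close>

lemma orthonormal_extend:
  fixes d :: "'a::real_inner"
  assumes S: "orthonormal S" "finite S"
  shows "\<exists>S'. orthonormal S' \<and> finite S' \<and> S \<subseteq> S' \<and> d \<in> span S'"
proof -
  let ?p = "\<Sum>e\<in>S. (d \<bullet> e) *\<^sub>R e"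
  let ?v = "d - ?p"
  have p: "?p \<in> span S'" if "S \<subseteq> S'" for S'
    by (intro span_sum span_scale) (use that in \<open>auto intro: span_base\<close>)
  show ?thesis
  proof (cases "?v = 0")
    case True
    then have "d \<in> span S" using p[of S] by simp
    then show ?thesis using S by blast
  next
    case False
    define u where "u = (1 / norm ?v) *\<^sub>R ?v"
    have u: "u \<bullet> e = 0" "e \<bullet> u = 0" if "e \<in> S" for e
      using orthonormal_sum_inner[OF S that, of d]
      by (simp_all add: u_def inner_diff_left inner_commute[of e])
    moreover have "norm u = 1" using False by (simp add: u_def)
    ultimately have "orthonormal (insert u S)"
      using S unfolding orthonormal_def by auto
    moreover have "d \<in> span (insert u S)"
    proof -
      have "d = norm ?v *\<^sub>R u + ?p" using False by (simp add: u_def)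
      also have "\<dots> \<in> span (insert u S)"
        by (intro span_add span_scale p) (auto intro: span_base)
      finally show ?thesis .
    qed
    ultimately show ?thesis using S by (intro exI[of _ "insert u S"]) auto
  qed
qed

lemma dense_sequence_exists:
  obtains d :: "nat \<Rightarrow> 'a::second_countable_topology" where "closure (range d) = UNIV"
proof -
  obtain D :: "'a set" where D: "countable D" "\<And>X. open X \<Longrightarrow> X \<noteq> {} \<Longrightarrow> \<exists>d\<in>D. d \<in> X"
    using countable_dense_exists by blast
  have "D \<noteq> {}" using D(2)[of UNIV] by auto
  then have "range (from_nat_into D) = D" using D(1) by (rule range_from_nat_into)
  moreover have "- closure D = {}"
    using D(2)[of "- closure D"] closure_subset[of D] by (metis ComplD closed_closure open_Compl subsetD)
  ultimately show thesis using that[of "from_nat_into D"] by auto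
qed

text \<open>Needed because \<open>fredholm_det_plus_id\<close> picks its basis by
  \<open>SOME\<close>. Gram-Schmidt along a dense sequence gives an increasing chain of finite
  orthonormal sets, whose union is the basis.\<close>

lemma orthonormal_basis_exists:
  "\<exists>E :: 'a::{real_inner,second_countable_topology} set. orthonormal_basis E"
proof -
  obtain d :: "nat \<Rightarrow> 'a" where d: "closure (range d) = UNIV" by (rule dense_sequence_exists)
  let ?P = "\<lambda>n S. orthonormal S \<and> finite S \<and> (\<forall>i<n. d i \<in> span S)"
  have "\<exists>f. \<forall>n. ?P n (f n) \<and> f n \<subseteq> f (Suc n)"
  proof (rule dependent_nat_choice)
    show "\<exists>S. ?P 0 S" by (rule exI[of _ "{}"]) (simp add: orthonormal_def)
    fix S n assume S: "?P n S"
    then obtain S' where "orthonormal S'" "finite S'" "S \<subseteq> S'" "d n \<in> span S'"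
      using orthonormal_extend[of S "d n"] by blast
    with S show "\<exists>S'. ?P (Suc n) S' \<and> S \<subseteq> S'"
      by (intro exI[of _ S']) (auto simp: less_Suc_eq intro: span_mono[THEN subsetD])
  qed
  then obtain f where f: "\<And>n. ?P n (f n)" "\<And>n. f n \<subseteq> f (Suc n)" by blast
  have mono: "f m \<subseteq> f n" if "m \<le> n" for m n
    using lift_Suc_mono_le[of f, OF f(2) that] .
  let ?E = "\<Union>n. f n"
  have "orthonormal ?E"
    unfolding orthonormal_def
  proof (intro conjI ballI impI)
    fix e assume "e \<in> ?E"
    then show "norm e = 1" using f(1) unfolding orthonormal_def by blast
  next
    fix e e' assume "e \<in> ?E" "e' \<in> ?E" "e \<noteq> e'"
    then obtain m n where "e \<in> f m" "e' \<in> f n" by blast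
    then have "e \<in> f (max m n)" "e' \<in> f (max m n)"
      using mono[of m "max m n"] mono[of n "max m n"] by auto
    then show "e \<bullet> e' = 0" using f(1) \<open>e \<noteq> e'\<close> unfolding orthonormal_def by blast
  qed
  moreover have "range d \<subseteq> span ?E"
  proof
    fix x assume "x \<in> range d"
    then obtain i where "x = d i" by blast
    then have "x \<in> span (f (Suc i))" using f(1)[of "Suc i"] by blast
    then show "x \<in> span ?E" by (rule span_mono[THEN subsetD, rotated]) blast
  qed
  then have "closure (range d) \<subseteq> closure (span ?E)" by (rule closure_mono)
  then have "closure (span ?E) = UNIV" unfolding d by blast
  ultimately have "orthonormal_basis ?E"
    by (simp only: orthonormal_basis_iff)
  then show ?thesis ..
qed

text \<open>A vector of \<open>span E\<close> close to \<open>x\<close> lies in the span of some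
  finite \<open>F0\<close>; on every larger finite \<open>F\<close> the orthogonal projection is at
  least as close. The limit is along finite subsets because infinite sums are defined by that
  filter.\<close>

lemma parseval_finite_subsets:
  assumes E: "orthonormal_basis E"
  shows "((\<lambda>F. \<Sum>e\<in>F. (x \<bullet> e) * (e \<bullet> y)) \<longlongrightarrow> x \<bullet> y) (finite_subsets_at_top E)"
proof (rule tendstoI)
  fix r :: real assume r: "r > 0"
  have oE: "orthonormal E" and dense: "closure (span E) = UNIV"
    using E by (auto simp: orthonormal_basis_iff)
  define \<epsilon> where "\<epsilon> = r / (norm y + 1)"
  have \<epsilon>: "\<epsilon> > 0" using r by (simp add: \<epsilon>_def add_nonneg_pos)
  have "x \<in> closure (span E)" using dense by simp
  then obtain v where v: "v \<in> span E" "dist v x < \<epsilon>"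
    using \<epsilon> unfolding closure_approachable by blast
  obtain F0 where F0: "finite F0" "F0 \<subseteq> E" "v \<in> span F0"
    using v(1) unfolding span_explicit[of E]
    by (auto intro!: that intro: span_sum span_scale span_base)
  show "\<forall>\<^sub>F F in finite_subsets_at_top E. dist (\<Sum>e\<in>F. (x \<bullet> e) * (e \<bullet> y)) (x \<bullet> y) < r"
    unfolding eventually_finite_subsets_at_top
  proof (intro exI[of _ F0] conjI allI impI F0)
    fix F assume F: "finite F \<and> F0 \<subseteq> F \<and> F \<subseteq> E"
    let ?p = "\<Sum>e\<in>F. (x \<bullet> e) *\<^sub>R e"
    have "norm (x - ?p) \<le> norm (x - v)"
      using F F0 oE by (intro orthonormal_best_approximation)
        (auto intro: orthonormal_subset span_mono[THEN subsetD])
    then have "norm (x - ?p) < \<epsilon>" using v by (simp add: dist_norm norm_minus_commute)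
    then have "norm (x - ?p) * norm y < r"
      using mult_less_le_imp_less[of "norm (x - ?p)" \<epsilon> "norm y" "norm y + 1"] r
        mult_le_less_imp_less[of "norm (x - ?p)" \<epsilon> "norm y" "norm y + 1"]
      by (cases "y = 0") (simp_all add: \<epsilon>_def add_nonneg_eq_0_iff)
    moreover have "(\<Sum>e\<in>F. (x \<bullet> e) * (e \<bullet> y)) = ?p \<bullet> y"
      by (simp add: inner_sum_left)
    then have "dist (\<Sum>e\<in>F. (x \<bullet> e) * (e \<bullet> y)) (x \<bullet> y) = \<bar>(x - ?p) \<bullet> y\<bar>"
      by (simp add: dist_real_def inner_diff_left abs_minus_commute)
    moreover have "\<bar>(x - ?p) \<bullet> y\<bar> \<le> norm (x - ?p) * norm y"
      by (rule Cauchy_Schwarz_ineq2)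
    ultimately show "dist (\<Sum>e\<in>F. (x \<bullet> e) * (e \<bullet> y)) (x \<bullet> y) < r" by simp
  qed
qed

section \<open>Gram determinants\<close>

text \<open>The entries are a function rather than a matrix, so that limits and measurability in
  each entry pass through the Leibniz formula.\<close>

definition det_plus_id :: "nat \<Rightarrow> (nat \<Rightarrow> nat \<Rightarrow> real) \<Rightarrow> real" where
  "det_plus_id n G = Determinant.det (Matrix.mat n n (\<lambda>(i, j). (if i = j then 1 else 0) + G i j))"

lemma det_mat_leibniz:
  "Determinant.det (Matrix.mat n n (\<lambda>(i, j). M i j))
    = (\<Sum>p | p permutes {0..<n}. of_int (sign p) * (\<Prod>i = 0..<n. M i (p i)))"
  for M :: "nat \<Rightarrow> nat \<Rightarrow> real"
proof (subst det_def'[where n = n], simp, intro sum.cong refl arg_cong2[of _ _ _ _ "(*)"] prod.cong)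
  fix p i assume "p \<in> {p. p permutes {0..<n}}" "i \<in> {0..<n}"
  then have "p i < n" by (auto simp: permutes_in_image)
  with \<open>i \<in> {0..<n}\<close> show "Matrix.mat n n (\<lambda>(i, j). M i j) $$ (i, p i) = M i (p i)" by simp
qed

lemma tendsto_det_plus_id:
  assumes "\<And>i j. i < n \<Longrightarrow> j < n \<Longrightarrow> ((\<lambda>x. G x i j) \<longlongrightarrow> H i j) L"
  shows "((\<lambda>x. det_plus_id n (G x)) \<longlongrightarrow> det_plus_id n H) L"
  unfolding det_plus_id_def det_mat_leibniz
proof (intro tendsto_intros)
  fix p i assume "p \<in> {p. p permutes {0..<n}}" "i \<in> {0..<n}"
  then have "p i < n" "i < n" by (auto simp: permutes_in_image)
  then show "((\<lambda>x. G x i (p i)) \<longlongrightarrow> H i (p i)) L" by (rule assms[rotated])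
qed

text \<open>Sylvester's identity: \<open>?M * ?T\<close> and \<open>?T * ?M\<close> have the same
  determinant, and both are block lower triangular, with \<open>1 + V * U\<close> and
  \<open>1 + U * V\<close> respectively as the only nontrivial diagonal block.\<close>

lemma det_one_plus_mult_commute:
  fixes U V :: "real mat"
  assumes U: "U \<in> carrier_mat N n" and V: "V \<in> carrier_mat n N"
  shows "Determinant.det (1\<^sub>m N + U * V) = Determinant.det (1\<^sub>m n + V * U)"
proof -
  let ?M = "four_block_mat (1\<^sub>m N) (- U) V (1\<^sub>m n)"
  let ?T = "four_block_mat (1\<^sub>m N) U (0\<^sub>m n N) (1\<^sub>m n)"
  have M: "?M \<in> carrier_mat (N + n) (N + n)" and T: "?T \<in> carrier_mat (N + n) (N + n)" by auto
  have dT: "Determinant.det ?T = 1"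
    using U by (subst det_four_block_mat_lower_left_zero[where n = N and m = n]) auto
  have UV: "U * V \<in> carrier_mat N N" "V * U \<in> carrier_mat n n" using U V by auto
  have "?M * ?T = four_block_mat (1\<^sub>m N) (0\<^sub>m N n) V (1\<^sub>m n + V * U)"
    using U V UV by (subst mult_four_block_mat[where ?nr1.0 = N and ?n1.0 = N and ?n2.0 = n and ?nr2.0 = n and ?nc1.0 = N and ?nc2.0 = n])
      (auto intro!: cong_four_block_mat simp: comm_add_mat[of "V * U" n n])
  moreover have "Determinant.det \<dots> = Determinant.det (1\<^sub>m n + V * U)"
    using U V by (subst det_four_block_mat_upper_right_zero[where n = N and m = n]) auto
  moreover have "?T * ?M = four_block_mat (1\<^sub>m N + U * V) (0\<^sub>m N n) V (1\<^sub>m n)"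
    using U V UV by (subst mult_four_block_mat[where ?nr1.0 = N and ?n1.0 = N and ?n2.0 = n and ?nr2.0 = n and ?nc1.0 = N and ?nc2.0 = n])
      (auto intro!: cong_four_block_mat)
  moreover have "Determinant.det \<dots> = Determinant.det (1\<^sub>m N + U * V)"
    using U V by (subst det_four_block_mat_upper_right_zero[where n = N and m = n]) auto
  ultimately show ?thesis
    using Determinant.det_mult[OF M T] Determinant.det_mult[OF T M] dT by simp
qed

text \<open>Schur complement of the last diagonal entry. Instead of inverting \<open>I + G\<close>,
  a solution \<open>b\<close> of \<open>(I + G) b =\<close> last column is supplied; multiplying by
  a unipotent matrix that contains \<open>- b\<close> clears that column.\<close>

lemma det_plus_id_Suc:
  assumes b: "\<And>i. i < n \<Longrightarrow> b i + (\<Sum>j<n. G i j * b j) = G i n"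
  shows "det_plus_id (Suc n) G = det_plus_id n G * (1 + G n n - (\<Sum>j<n. G n j * b j))"
proof -
  let ?P = "Matrix.mat n n (\<lambda>(i, j). (if i = j then 1 else 0) + G i j)"
  let ?q = "Matrix.mat n 1 (\<lambda>(i, j). G i n)" and ?q' = "Matrix.mat 1 n (\<lambda>(i, j). G n j)"
  let ?r = "Matrix.mat 1 1 (\<lambda>(i, j). 1 + G n n)"
  let ?b = "Matrix.mat n 1 (\<lambda>(i, j). - b i)"
  let ?M = "four_block_mat ?P ?q ?q' ?r"
  let ?T = "four_block_mat (1\<^sub>m n) ?b (0\<^sub>m 1 n) (1\<^sub>m 1)"
  let ?s = "Matrix.mat 1 1 (\<lambda>(i, j). 1 + G n n - (\<Sum>j<n. G n j * b j))"
  have M: "?M \<in> carrier_mat (n + 1) (n + 1)" and T: "?T \<in> carrier_mat (n + 1) (n + 1)" by auto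
  have dT: "Determinant.det ?T = 1"
    by (subst det_four_block_mat_lower_left_zero[where n = n and m = 1]) auto
  have Mdet: "det_plus_id (Suc n) G = Determinant.det ?M"
    unfolding det_plus_id_def
    by (rule arg_cong[of _ _ Determinant.det]) (auto intro!: eq_matI simp: less_Suc_eq)
  have Pb: "?P * ?b + ?q * 1\<^sub>m 1 = 0\<^sub>m n 1"
  proof (rule eq_matI)
    fix i j assume "i < dim_row (0\<^sub>m n 1 :: real mat)" "j < dim_col (0\<^sub>m n 1 :: real mat)"
    then have i: "i < n" "j = 0" by auto
    have "(?P * ?b) $$ (i, 0) = (\<Sum>k = 0..<n. ((if i = k then 1 else 0) + G i k) * - b k)"
      using i by (simp add: scalar_prod_def)
    also have "\<dots> = (\<Sum>k<n. (if i = k then - b k else 0) + - (G i k * b k))"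
      by (auto simp: atLeast0LessThan algebra_simps intro!: sum.cong)
    also have "\<dots> = - b i - (\<Sum>k<n. G i k * b k)"
      unfolding sum.distrib using i by (simp add: sum_negf)
    also have "\<dots> = - G i n" using b[OF i(1)] by simp
    finally show "(?P * ?b + ?q * 1\<^sub>m 1) $$ (i, j) = (0\<^sub>m n 1) $$ (i, j)"
      using i by simp
  qed auto
  have qb: "?q' * ?b + ?r * 1\<^sub>m 1 = ?s"
    by (rule eq_matI) (auto simp: scalar_prod_def atLeast0LessThan sum_negf)
  have "?M * ?T = four_block_mat ?P (0\<^sub>m n 1) ?q' ?s"
    unfolding Pb[symmetric] qb[symmetric]
    by (subst mult_four_block_mat[where ?nr1.0 = n and ?n1.0 = n and ?n2.0 = 1 and ?nr2.0 = 1 and ?nc1.0 = n and ?nc2.0 = 1])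
      (auto intro!: cong_four_block_mat)
  then have "Determinant.det ?M = Determinant.det (four_block_mat ?P (0\<^sub>m n 1) ?q' ?s)"
    using Determinant.det_mult[OF M T] dT by simp
  also have "\<dots> = Determinant.det ?P * Determinant.det ?s"
    by (subst det_four_block_mat_upper_right_zero[where n = n and m = 1]) auto
  also have "Determinant.det ?s = 1 + G n n - (\<Sum>j<n. G n j * b j)"
    by (simp add: det_single)
  finally show ?thesis unfolding Mdet det_plus_id_def[of n] .
qed

lemma sum_rank_one_apply:
  "blinfun_apply (\<Sum>i\<in>I. rank_one (z i)) x = (\<Sum>i\<in>I. (z i \<bullet> x) *\<^sub>R z i)"
  by (simp add: blinfun.sum_left rank_one_apply)

lemma coercive_op_plus_sum_rank_one:
  assumes "coercive_op T" "\<And>i. i \<in> I \<Longrightarrow> 0 \<le> c i"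
  shows "coercive_op (T + (\<Sum>i\<in>I. c i *\<^sub>R rank_one (z i)))"
proof (cases "finite I")
  case True
  then show ?thesis using assms(2)
  proof (induction I rule: finite_induct)
    case (insert i I)
    then have "coercive_op ((T + (\<Sum>i\<in>I. c i *\<^sub>R rank_one (z i))) + c i *\<^sub>R rank_one (z i))"
      by (intro coercive_op_plus_rank_one) auto
    with insert show ?case by (simp add: algebra_simps)
  qed (simp add: assms)
qed (simp add: assms)

lemma coercive_op_id_plus_sum_rank_one:
  "coercive_op (id_blinfun + (\<Sum>i\<in>I. rank_one (z i)))"
  using coercive_op_plus_sum_rank_one[of id_blinfun I "\<lambda>_. 1" z] coercive_op_scaleR_id[of 1] by simp

text \<open>The linear system of the Schur complement is solved in the Hilbert space:
  \<open>b i = <z i, w>\<close> with \<open>w = (I + sum of z i \<otimes> z i)^{-1} (z n)\<close>,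
  since pairing the equation for \<open>w\<close> with \<open>z i\<close> is row \<open>i\<close> of
  the system.\<close>

lemma gram_det_Suc:
  fixes z :: "nat \<Rightarrow> 'a::{real_inner,banach}"
  shows "det_plus_id (Suc n) (\<lambda>i j. z i \<bullet> z j) = det_plus_id n (\<lambda>i j. z i \<bullet> z j)
    * (1 + inv_form (id_blinfun + (\<Sum>i<n. rank_one (z i))) (z n) (z n))"
proof -
  let ?T = "id_blinfun + (\<Sum>i<n. rank_one (z i))"
  define w where "w = blinfun_apply (op_inverse ?T) (z n)"
  have "blinfun_apply ?T w = z n"
    unfolding w_def by (rule op_inverse_right[OF coercive_op_id_plus_sum_rank_one])
  then have zn: "z n = w + (\<Sum>j<n. (z j \<bullet> w) *\<^sub>R z j)"
    by (simp add: blinfun.add_left sum_rank_one_apply)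
  have eq: "z i \<bullet> w + (\<Sum>j<n. (z i \<bullet> z j) * (z j \<bullet> w)) = z i \<bullet> z n" for i
    by (subst zn) (simp add: inner_add_right inner_sum_right mult.commute)
  have "1 + z n \<bullet> z n - (\<Sum>j<n. (z n \<bullet> z j) * (z j \<bullet> w)) = 1 + z n \<bullet> w"
    using eq[of n] by simp
  then show ?thesis
    using det_plus_id_Suc[of n "\<lambda>i. z i \<bullet> w" "\<lambda>i j. z i \<bullet> z j"] eq
    by (simp add: inv_form_def w_def)
qed

lemma gram_det_eq_prod:
  fixes z :: "nat \<Rightarrow> 'a::{real_inner,banach}"
  shows "det_plus_id n (\<lambda>i j. z i \<bullet> z j)
    = (\<Prod>k<n. 1 + inv_form (id_blinfun + (\<Sum>i<k. rank_one (z i))) (z k) (z k))"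
proof (induction n)
  case 0
  show ?case by (simp add: det_plus_id_def)
next
  case (Suc n)
  then show ?case by (simp add: gram_det_Suc)
qed

lemma gram_det_ge_1:
  fixes z :: "nat \<Rightarrow> 'a::{real_inner,banach}"
  shows "1 \<le> det_plus_id n (\<lambda>i j. z i \<bullet> z j)"
  unfolding gram_det_eq_prod
  by (rule prod_ge_1) (simp add: inv_form_nonneg coercive_op_id_plus_sum_rank_one)

section \<open>The Fredholm determinant of a finite rank perturbation of the identity\<close>

text \<open>Minors are indexed by unordered sets of basis vectors, determinants by an initial
  segment of the naturals. Transport along \<open>h\<close> is a bijection of permutations that
  preserves the sign.\<close>

lemma leibniz_sum_eq_det:
  fixes g :: "'b \<Rightarrow> 'b \<Rightarrow> real"
  assumes h: "bij_betw h {0..<N} F"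
  shows "(\<Sum>p | p permutes F. of_int (sign p) * (\<Prod>e\<in>F. g e (p e)))
    = Determinant.det (Matrix.mat N N (\<lambda>(i, j). g (h i) (h j)))"
proof -
  let ?I = "{0..<N}"
  let ?\<phi> = "map_permutation ?I h" and ?\<psi> = "map_permutation F (inv_into ?I h)"
  have h': "bij_betw (inv_into ?I h) F ?I" by (rule bij_betw_inv_into[OF h])
  have inj: "inj_on h ?I" using h by (simp add: bij_betw_def)
  have "bij_betw ?\<phi> {p. p permutes ?I} {p. p permutes F}"
  proof (rule bij_betw_byWitness[where f' = ?\<psi>])
    show "\<forall>p\<in>{p. p permutes ?I}. ?\<psi> (?\<phi> p) = p"
      using h inj by (auto intro!: map_permutation_compose_inv)
    show "\<forall>p\<in>{p. p permutes F}. ?\<phi> (?\<psi> p) = p"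
      using h h' by (auto intro!: map_permutation_compose_inv simp: bij_betw_inv_into_right)
    show "?\<phi> ` {p. p permutes ?I} \<subseteq> {p. p permutes F}"
      using h by (auto intro: map_permutation_permutes)
    show "?\<psi> ` {p. p permutes F} \<subseteq> {p. p permutes ?I}"
      using h' by (auto intro: map_permutation_permutes)
  qed
  then have "(\<Sum>p | p permutes F. of_int (sign p) * (\<Prod>e\<in>F. g e (p e)))
      = (\<Sum>p | p permutes ?I. of_int (sign (?\<phi> p)) * (\<Prod>e\<in>F. g e (?\<phi> p e)))"
    using sum.reindex_bij_betw[of ?\<phi> _ _ "\<lambda>p. of_int (sign p) * (\<Prod>e\<in>F. g e (p e))"] by simp
  also have "\<dots> = (\<Sum>p | p permutes ?I. of_int (sign p) * (\<Prod>i = 0..<N. g (h i) (h (p i))))"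
  proof (intro sum.cong refl arg_cong2[of _ _ _ _ "(*)"])
    fix p assume "p \<in> {p. p permutes ?I}"
    then have p: "p permutes ?I" by simp
    then show "real_of_int (sign (?\<phi> p)) = real_of_int (sign p)"
      using inj by (simp add: sign_map_permutation)
    have "(\<Prod>e\<in>F. g e (?\<phi> p e)) = (\<Prod>i\<in>?I. g (h i) (?\<phi> p (h i)))"
      using prod.reindex_bij_betw[OF h, of "\<lambda>e. g e (?\<phi> p e)"] by simp
    also have "\<dots> = (\<Prod>i\<in>?I. g (h i) (h (p i)))"
      using inj by (intro prod.cong) (auto simp: map_permutation_apply)
    finally show "(\<Prod>e\<in>F. g e (?\<phi> p e)) = (\<Prod>i\<in>?I. g (h i) (h (p i)))" .
  qed
  finally show ?thesis by (simp add: det_mat_leibniz)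
qed

text \<open>Expand the product over \<open>F\<close> according to the set \<open>S\<close> of
  factors where the entry of \<open>A\<close> is chosen. A permutation contributes only if it fixes
  \<open>F - S\<close>, that is, if it permutes \<open>S\<close>.\<close>

lemma sum_principal_minors:
  assumes F: "finite F"
  shows "(\<Sum>S\<in>Pow F. principal_minor A S)
    = (\<Sum>p | p permutes F. of_int (sign p) * (\<Prod>e\<in>F. (if e = p e then 1 else 0) + e \<bullet> blinfun_apply A (p e)))"
proof -
  have "(\<Sum>p | p permutes F. of_int (sign p) * (\<Prod>e\<in>F. (if e = p e then 1 else 0) + e \<bullet> blinfun_apply A (p e)))
      = (\<Sum>p | p permutes F. of_int (sign p) * (\<Prod>e\<in>F. e \<bullet> blinfun_apply A (p e) + (if e = p e then 1 else 0)))"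
    by (simp add: add.commute)
  also have "\<dots> = (\<Sum>p | p permutes F. \<Sum>S\<in>Pow F. of_int (sign p)
      * ((\<Prod>e\<in>S. e \<bullet> blinfun_apply A (p e)) * (\<Prod>e\<in>F - S. if e = p e then 1 else 0)))"
    by (simp only: prod_add[OF F] sum_distrib_left)
  also have "\<dots> = (\<Sum>S\<in>Pow F. \<Sum>p | p permutes F. of_int (sign p)
      * ((\<Prod>e\<in>S. e \<bullet> blinfun_apply A (p e)) * (\<Prod>e\<in>F - S. if e = p e then 1 else 0)))"
    by (rule sum.swap)
  also have "\<dots> = (\<Sum>S\<in>Pow F. principal_minor A S)"
    unfolding principal_minor_def
  proof (rule sum.cong[OF refl], rule sum.mono_neutral_cong_right)
    fix S assume "S \<in> Pow F"
    then have S: "S \<subseteq> F" by simp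
    show "finite {p. p permutes F}" using F by (rule finite_permutations)
    show "{p. p permutes S} \<subseteq> {p. p permutes F}" using S permutes_subset by auto
    show "\<forall>p\<in>{p. p permutes F} - {p. p permutes S}. of_int (sign p)
        * ((\<Prod>e\<in>S. e \<bullet> blinfun_apply A (p e)) * (\<Prod>e\<in>F - S. if e = p e then 1 else 0)) = 0"
    proof
      fix p assume "p \<in> {p. p permutes F} - {p. p permutes S}"
      then have "\<not> (\<forall>e\<in>F - S. p e = e)" using permutes_superset[of p F S] by auto
      then obtain e where "e \<in> F - S" "e \<noteq> p e" by force
      then have "(\<Prod>e\<in>F - S. if e = p e then 1 else 0 :: real) = 0"
        using F by (intro prod_zero) auto
      then show "of_int (sign p) * ((\<Prod>e\<in>S. e \<bullet> blinfun_apply A (p e))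
          * (\<Prod>e\<in>F - S. if e = p e then 1 else 0)) = 0" by simp
    qed
    fix p assume "p \<in> {p. p permutes S}"
    then have "(\<Prod>e\<in>F - S. if e = p e then 1 else 0 :: real) = 1"
      by (intro prod.neutral) (auto simp: permutes_not_in)
    then show "of_int (sign p) * ((\<Prod>e\<in>S. e \<bullet> blinfun_apply A (p e))
          * (\<Prod>e\<in>F - S. if e = p e then 1 else 0)) = of_int (sign p) * (\<Prod>e\<in>S. e \<bullet> blinfun_apply A (p e))"
      by simp
  qed
  finally show ?thesis by simp
qed

text \<open>Compressed to \<open>F\<close> the operator is \<open>?U * ?V\<close> with
  \<open>n\<close> as inner dimension. Sylvester's identity gives a determinant whose size no longer
  depends on \<open>F\<close> and whose entries are partial Parseval sums, ready for a
  limit.\<close>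

lemma sum_principal_minors_rank_one:
  assumes F: "finite F"
  shows "(\<Sum>S\<in>Pow F. principal_minor (\<Sum>i<n. rank_one (z i)) S)
    = det_plus_id n (\<lambda>i j. \<Sum>e\<in>F. (z i \<bullet> e) * (e \<bullet> z j))"
proof -
  obtain h where h: "bij_betw h {0..<card F} F"
    using ex_bij_betw_nat_finite[OF F] by blast
  let ?N = "card F"
  let ?U = "Matrix.mat ?N n (\<lambda>(k, i). h k \<bullet> z i)" and ?V = "Matrix.mat n ?N (\<lambda>(i, k). z i \<bullet> h k)"
  have inj: "h k = h l \<longleftrightarrow> k = l" if "k < ?N" "l < ?N" for k l
    using h that by (auto simp: bij_betw_def inj_on_def)
  have "(\<Sum>S\<in>Pow F. principal_minor (\<Sum>i<n. rank_one (z i)) S)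
      = Determinant.det (Matrix.mat ?N ?N (\<lambda>(k, l). (if h k = h l then 1 else 0)
          + h k \<bullet> blinfun_apply (\<Sum>i<n. rank_one (z i)) (h l)))"
    unfolding sum_principal_minors[OF F] leibniz_sum_eq_det[OF h, of "\<lambda>e f. (if e = f then 1 else 0)
          + e \<bullet> blinfun_apply (\<Sum>i<n. rank_one (z i)) f"] ..
  also have "Matrix.mat ?N ?N (\<lambda>(k, l). (if h k = h l then 1 else 0)
          + h k \<bullet> blinfun_apply (\<Sum>i<n. rank_one (z i)) (h l)) = 1\<^sub>m ?N + ?U * ?V"
    by (rule eq_matI) (auto simp: inj scalar_prod_def sum_rank_one_apply inner_sum_right atLeast0LessThan
        mult.commute)
  also have "Determinant.det (1\<^sub>m ?N + ?U * ?V) = Determinant.det (1\<^sub>m n + ?V * ?U)"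
    by (rule det_one_plus_mult_commute) auto
  also have "1\<^sub>m n + ?V * ?U = Matrix.mat n n (\<lambda>(i, j). (if i = j then 1 else 0) + (\<Sum>e\<in>F. (z i \<bullet> e) * (e \<bullet> z j)))"
    by (rule eq_matI) (auto simp: scalar_prod_def sum.reindex_bij_betw[OF h, symmetric])
  finally show ?thesis by (simp add: det_plus_id_def)
qed

text \<open>The partial Parseval sums are the Gram matrix of the orthogonal projections of the
  \<open>z i\<close> to the span of \<open>F\<close>, so \<open>gram_det_ge_1\<close>
  applies.\<close>

lemma sum_principal_minors_rank_one_ge_1:
  fixes z :: "nat \<Rightarrow> 'a::{real_inner,banach}"
  assumes F: "finite F" "orthonormal F"
  shows "1 \<le> (\<Sum>S\<in>Pow F. principal_minor (\<Sum>i<n. rank_one (z i)) S)"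
proof -
  let ?p = "\<lambda>i. \<Sum>e\<in>F. (z i \<bullet> e) *\<^sub>R e"
  have gen: "?p i \<bullet> w = (\<Sum>e\<in>F. (z i \<bullet> e) * (w \<bullet> e))" for i w
    by (simp add: inner_sum_left inner_commute[of w])
  have "?p i \<bullet> ?p j = (\<Sum>e\<in>F. (z i \<bullet> e) * (e \<bullet> z j))" for i j
  proof -
    have "?p i \<bullet> ?p j = (\<Sum>e\<in>F. (z i \<bullet> e) * (?p j \<bullet> e))" by (rule gen)
    also have "\<dots> = (\<Sum>e\<in>F. (z i \<bullet> e) * (e \<bullet> z j))"
      using F by (intro sum.cong refl) (simp add: orthonormal_sum_inner inner_commute[of _ "z j"])
    finally show ?thesis .
  qed
  then show ?thesis
    using gram_det_ge_1[of n ?p] by (simp add: sum_principal_minors_rank_one[OF F(1)])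
qed

text \<open>For \<open>t > 0\<close> the minor of \<open>t I + A\<close> is \<open>t\<close> to the power \<open>card S\<close> times a determinant
  \<open>det (I + A / t) \<ge> 1\<close> as above; now let \<open>t\<close> tend to \<open>0\<close>.\<close>

lemma principal_minor_rank_one_nonneg:
  fixes z :: "nat \<Rightarrow> 'a::{real_inner,banach}"
  assumes S: "finite S" "orthonormal S"
  shows "0 \<le> principal_minor (\<Sum>i<n. rank_one (z i)) S"
proof -
  let ?A = "\<Sum>i<n. rank_one (z i)"
  let ?m = "\<lambda>t. \<Sum>p | p permutes S. of_int (sign p) * (\<Prod>e\<in>S. t * (if e = p e then 1 else 0) + e \<bullet> blinfun_apply ?A (p e))"
  have pos: "0 \<le> ?m t" if t: "t > 0" for t
  proof -
    \<comment> \<open>\<open>rank_one\<close> is quadratic, so this scaling divides the operator by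
      \<open>t\<close>.\<close>
    let ?z = "\<lambda>i. (1 / sqrt t) *\<^sub>R z i"
    have A: "e \<bullet> blinfun_apply ?A f = t * (e \<bullet> blinfun_apply (\<Sum>i<n. rank_one (?z i)) f)" for e f
      using t by (simp add: rank_one_scaleR power_divide blinfun.bilinear_simps
          flip: scaleR_sum_right)
    have "?m t = (\<Sum>p | p permutes S. t ^ card S * (of_int (sign p)
        * (\<Prod>e\<in>S. (if e = p e then 1 else 0) + e \<bullet> blinfun_apply (\<Sum>i<n. rank_one (?z i)) (p e))))"
      unfolding A distrib_left[symmetric] prod.distrib by (simp add: mult_ac)
    also have "\<dots> = t ^ card S * (\<Sum>T\<in>Pow S. principal_minor (\<Sum>i<n. rank_one (?z i)) T)"
      unfolding sum_principal_minors[OF S(1)] sum_distrib_left ..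
    also have "\<dots> \<ge> 0"
      using t order_trans[OF zero_le_one sum_principal_minors_rank_one_ge_1[OF S, of ?z n]]
      by (intro mult_nonneg_nonneg) auto
    finally show ?thesis .
  qed
  have "(?m \<longlongrightarrow> ?m 0) (at_right 0)"
    by (intro tendsto_intros)
  moreover have "\<forall>\<^sub>F t in at_right 0. 0 \<le> ?m t"
    using pos by (auto intro: eventually_at_right_less[THEN eventually_mono])
  ultimately have "0 \<le> ?m 0"
    by (rule tendsto_lowerbound) simp
  then show ?thesis by (simp add: principal_minor_def)
qed

text \<open>The limit along sets \<open>F\<close> of basis vectors has to become a sum over all
  finite subsets of \<open>E\<close>, that is, a limit along finite families of such sets.
  Nonnegative minors make this possible: power sets of finite \<open>F\<close> are cofinal among the
  families, and the partial sums are monotone.\<close>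

theorem fredholm_det_plus_id_rank_one:
  fixes z :: "nat \<Rightarrow> 'a::{real_inner,banach,second_countable_topology}"
  shows "fredholm_det_plus_id (\<Sum>i<n. rank_one (z i)) = det_plus_id n (\<lambda>i j. z i \<bullet> z j)"
proof -
  let ?A = "\<Sum>i<n. rank_one (z i)"
  define E :: "'a set" where "E = (SOME E. orthonormal_basis E)"
  have E: "orthonormal_basis E"
    unfolding E_def by (rule someI_ex[OF orthonormal_basis_exists])
  then have oE: "orthonormal E" by (simp add: orthonormal_basis_iff)
  define L where "L = det_plus_id n (\<lambda>i j. z i \<bullet> z j)"
  define D where "D F = (\<Sum>S\<in>Pow F. principal_minor ?A S)" for F
  have minor: "0 \<le> principal_minor ?A S" if "finite S" "S \<subseteq> E" for S
    using that oE by (intro principal_minor_rank_one_nonneg) (auto intro: orthonormal_subset)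
  have "((\<lambda>F. det_plus_id n (\<lambda>i j. \<Sum>e\<in>F. (z i \<bullet> e) * (e \<bullet> z j))) \<longlongrightarrow> L) (finite_subsets_at_top E)"
    unfolding L_def by (intro tendsto_det_plus_id parseval_finite_subsets E)
  moreover have "\<forall>\<^sub>F F in finite_subsets_at_top E. det_plus_id n (\<lambda>i j. \<Sum>e\<in>F. (z i \<bullet> e) * (e \<bullet> z j)) = D F"
    unfolding D_def
    by (rule eventually_finite_subsets_at_top_weakI) (simp add: sum_principal_minors_rank_one)
  ultimately have lim: "(D \<longlongrightarrow> L) (finite_subsets_at_top E)"
    by (rule Lim_transform_eventually)
  have mono: "D F \<le> D F'" if "F \<subseteq> F'" "finite F'" "F' \<subseteq> E" for F F'
    unfolding D_def using that by (intro sum_mono2 minor) (auto dest: finite_subset)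
  have le: "D F \<le> L" if "finite F" "F \<subseteq> E" for F
  proof (rule tendsto_lowerbound[OF lim])
    show "\<forall>\<^sub>F F' in finite_subsets_at_top E. D F \<le> D F'"
      unfolding eventually_finite_subsets_at_top
      using that mono by (intro exI[of _ F]) auto
  qed simp
  have "((\<lambda>S. principal_minor ?A S) has_sum L) {S. finite S \<and> S \<subseteq> E}"
    unfolding has_sum_def
  proof (rule order_tendstoI)
    fix a assume "a < L"
    then have "\<forall>\<^sub>F F in finite_subsets_at_top E. a < D F"
      using lim by (simp add: order_tendsto_iff)
    then obtain F where F: "finite F" "F \<subseteq> E" "a < D F"
      unfolding eventually_finite_subsets_at_top by blast
    show "\<forall>\<^sub>F \<S> in finite_subsets_at_top {S. finite S \<and> S \<subseteq> E}. a < (\<Sum>S\<in>\<S>. principal_minor ?A S)"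
      unfolding eventually_finite_subsets_at_top
    proof (intro exI[of _ "Pow F"] conjI allI impI)
      show "finite (Pow F)" "Pow F \<subseteq> {S. finite S \<and> S \<subseteq> E}"
        using F by (auto dest: finite_subset)
      fix \<S> assume "finite \<S> \<and> Pow F \<subseteq> \<S> \<and> \<S> \<subseteq> {S. finite S \<and> S \<subseteq> E}"
      then have "D F \<le> (\<Sum>S\<in>\<S>. principal_minor ?A S)"
        unfolding D_def by (intro sum_mono2 minor) auto
      with F show "a < (\<Sum>S\<in>\<S>. principal_minor ?A S)" by simp
    qed
  next
    fix a assume a: "L < a"
    show "\<forall>\<^sub>F \<S> in finite_subsets_at_top {S. finite S \<and> S \<subseteq> E}. (\<Sum>S\<in>\<S>. principal_minor ?A S) < a"
    proof (rule eventually_finite_subsets_at_top_weakI)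
      fix \<S> assume \<S>: "finite \<S>" "\<S> \<subseteq> {S. finite S \<and> S \<subseteq> E}"
      then have U: "finite (\<Union>\<S>)" "\<Union>\<S> \<subseteq> E" by auto
      have "(\<Sum>S\<in>\<S>. principal_minor ?A S) \<le> D (\<Union>\<S>)"
        unfolding D_def using U by (intro sum_mono2 minor) (auto dest: finite_subset)
      also have "\<dots> \<le> L" by (rule le[OF U])
      finally show "(\<Sum>S\<in>\<S>. principal_minor ?A S) < a" using a by simp
    qed
  qed
  then show ?thesis
    unfolding fredholm_det_plus_id_def Let_def E_def[symmetric] L_def[symmetric]
    by (rule infsumI)
qed

section \<open>Rank one updates and monotonicity of the determinant\<close>

text \<open>The enumeration puts \<open>x\<close> last. Since the operator does not depend on the
  order of its summands, any summand may play the role of the last one.\<close>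

lemma fredholm_det_plus_rank_one:
  fixes z :: "'i \<Rightarrow> 'a::{real_inner,banach,second_countable_topology}"
  assumes J: "finite J"
  shows "1 \<le> fredholm_det_plus_id (\<Sum>j\<in>J. rank_one (z j))"
    and "fredholm_det_plus_id ((\<Sum>j\<in>J. rank_one (z j)) + rank_one x)
      = fredholm_det_plus_id (\<Sum>j\<in>J. rank_one (z j))
        * (1 + inv_form (id_blinfun + (\<Sum>j\<in>J. rank_one (z j))) x x)"
proof -
  obtain h where h: "bij_betw h {0..<card J} J"
    using ex_bij_betw_nat_finite[OF J] by blast
  let ?n = "card J"
  define u where "u i = (if i < ?n then z (h i) else x)" for i
  have u: "(\<Sum>j\<in>J. rank_one (z j)) = (\<Sum>i<?n. rank_one (u i))"
    using sum.reindex_bij_betw[OF h, of "\<lambda>j. rank_one (z j)"]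
    by (simp add: u_def atLeast0LessThan)
  then have u': "(\<Sum>j\<in>J. rank_one (z j)) + rank_one x = (\<Sum>i<Suc ?n. rank_one (u i))"
    by (simp add: u_def)
  show "1 \<le> fredholm_det_plus_id (\<Sum>j\<in>J. rank_one (z j))"
    unfolding u fredholm_det_plus_id_rank_one by (rule gram_det_ge_1)
  show "fredholm_det_plus_id ((\<Sum>j\<in>J. rank_one (z j)) + rank_one x)
      = fredholm_det_plus_id (\<Sum>j\<in>J. rank_one (z j))
        * (1 + inv_form (id_blinfun + (\<Sum>j\<in>J. rank_one (z j))) x x)"
    unfolding u' unfolding u fredholm_det_plus_id_rank_one gram_det_Suc by (simp add: u_def[of ?n])
qed

text \<open>Restore the factors \<open>c j\<close> to 1 one index at a time. With the changed
  summand taken last, only its inverse form changes, by the factor \<open>(c k)^2 \<le> 1\<close>.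
  \<open>d K\<close> is the hybrid in which the indices of \<open>K\<close> are already
  restored.\<close>

lemma fredholm_det_rank_one_mono:
  fixes z :: "'i \<Rightarrow> 'a::{real_inner,banach,second_countable_topology}"
  assumes J: "finite J" and c: "\<And>j. j \<in> J \<Longrightarrow> 0 \<le> c j \<and> c j \<le> 1"
  shows "fredholm_det_plus_id (\<Sum>j\<in>J. rank_one (c j *\<^sub>R z j)) \<le> fredholm_det_plus_id (\<Sum>j\<in>J. rank_one (z j))"
proof -
  define d where "d K j = (if j \<in> K then z j else c j *\<^sub>R z j)" for K j
  have "fredholm_det_plus_id (\<Sum>j\<in>J. rank_one (c j *\<^sub>R z j)) \<le> fredholm_det_plus_id (\<Sum>j\<in>J. rank_one (d K j))"
    if "finite K" "K \<subseteq> J" for K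
    using that
  proof (induction K rule: finite_induct)
    case empty
    then show ?case by (simp add: d_def)
  next
    case (insert k K)
    let ?B = "\<Sum>j\<in>J - {k}. rank_one (d K j)"
    have k: "k \<in> J" "k \<notin> K" using insert by auto
    have "0 \<le> inv_form (id_blinfun + ?B) (z k) (z k)"
      by (intro inv_form_nonneg coercive_op_id_plus_sum_rank_one)
    moreover have "(c k)\<^sup>2 \<le> 1" using c[OF k(1)] by (simp add: power_le_one)
    ultimately have "inv_form (id_blinfun + ?B) (c k *\<^sub>R z k) (c k *\<^sub>R z k) \<le> inv_form (id_blinfun + ?B) (z k) (z k)"
      using mult_right_mono[of "(c k)\<^sup>2" 1 "inv_form (id_blinfun + ?B) (z k) (z k)"]
      by (simp add: inv_form_def blinfun.bilinear_simps power2_eq_square)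
    moreover have "0 \<le> fredholm_det_plus_id ?B"
      using fredholm_det_plus_rank_one(1)[of "J - {k}" "d K"] J by simp
    ultimately have "fredholm_det_plus_id (?B + rank_one (c k *\<^sub>R z k)) \<le> fredholm_det_plus_id (?B + rank_one (z k))"
      using J by (simp add: fredholm_det_plus_rank_one(2) mult_left_mono)
    moreover have "(\<Sum>j\<in>J. rank_one (d K j)) = ?B + rank_one (c k *\<^sub>R z k)"
      using J k by (simp add: sum.remove[of J k] d_def add.commute)
    moreover have "?B = (\<Sum>j\<in>J - {k}. rank_one (d (insert k K) j))"
      by (intro sum.cong) (auto simp: d_def)
    then have "(\<Sum>j\<in>J. rank_one (d (insert k K) j)) = ?B + rank_one (z k)"
      using J k by (simp add: sum.remove[of J k] d_def add.commute)
    ultimately show ?case using insert by simp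
  qed
  from this[of J] show ?thesis using J by (simp add: d_def)
qed

lemma inv_form_scaleR:
  fixes T :: "'a::{real_inner,banach} \<Rightarrow>\<^sub>L 'a"
  assumes T: "coercive_op T" and c: "c > 0"
  shows "inv_form (c *\<^sub>R T) u v = inv_form T u v / c"
proof -
  obtain k where "k > 0" "\<forall>x. k * (x \<bullet> x) \<le> x \<bullet> blinfun_apply T x"
    using T unfolding coercive_op_def by blast
  then have "c * k > 0 \<and> (\<forall>x. c * k * (x \<bullet> x) \<le> x \<bullet> blinfun_apply (c *\<^sub>R T) x)"
    using c by (simp add: blinfun.bilinear_simps mult.assoc)
  then have "coercive_op (c *\<^sub>R T)"
    using T unfolding coercive_op_def by blast
  then have "op_inverse (c *\<^sub>R T) = (1 / c) *\<^sub>R op_inverse T"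
    using c by (intro op_inverse_eqI) (simp_all add: blinfun.bilinear_simps op_inverse_right[OF T])
  then show ?thesis by (simp add: inv_form_def blinfun.bilinear_simps)
qed

text \<open>With \<open>y i = sqrt (s i / \<rho>) x i\<close> the logarithms are those of the
  factors of a Gram determinant, so their sum is \<open>ln det (I + Q / \<rho>)\<close>. Since
  \<open>sqrt (s i) \<le> 1\<close>, monotonicity replaces \<open>Q\<close> by \<open>V\<close>; the
  factor 2 undoes the \<open>1/2\<close> in \<open>info_gain\<close>.\<close>

theorem sum_ln_inv_form_le_info_gain:
  fixes x :: "nat \<Rightarrow> 'a::{real_inner,banach,second_countable_topology}"
  assumes \<rho>: "\<rho> > 0" and s: "\<And>i. 0 \<le> s i \<and> s i \<le> 1"
  shows "(\<Sum>k<n. ln (1 + s k * inv_form (\<rho> *\<^sub>R id_blinfun + (\<Sum>i<k. s i *\<^sub>R rank_one (x i))) (x k) (x k)))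
    \<le> 2 * info_gain ((1 / \<rho>) *\<^sub>R (\<Sum>i<n. rank_one (x i)))"
proof -
  let ?T = "\<lambda>k. \<rho> *\<^sub>R id_blinfun + (\<Sum>i<k. s i *\<^sub>R rank_one (x i))"
  have T: "coercive_op (?T k)" for k
    using \<rho> s by (intro coercive_op_plus_sum_rank_one coercive_op_scaleR_id) auto
  define z where "z i = sqrt (1 / \<rho>) *\<^sub>R x i" for i
  define y where "y i = sqrt (s i) *\<^sub>R z i" for i
  have z: "rank_one (z i) = (1 / \<rho>) *\<^sub>R rank_one (x i)" for i
    using \<rho> by (simp add: z_def rank_one_scaleR del: real_sqrt_divide)
  have y: "rank_one (y i) = (1 / \<rho>) *\<^sub>R (s i *\<^sub>R rank_one (x i))" for i
    using s by (simp add: y_def rank_one_scaleR z)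
  have "id_blinfun + (\<Sum>i<k. rank_one (y i)) = (1 / \<rho>) *\<^sub>R ?T k" for k
    using \<rho> by (simp add: y scaleR_add_right scaleR_sum_right)
  then have "inv_form (id_blinfun + (\<Sum>i<k. rank_one (y i))) (y k) (y k) = \<rho> * inv_form (?T k) (y k) (y k)" for k
    using \<rho> by (simp add: inv_form_scaleR[OF T])
  also have "\<rho> * inv_form (?T k) (y k) (y k) = s k * inv_form (?T k) (x k) (x k)" for k
  proof -
    have "inv_form (?T k) (y k) (y k) = (sqrt (s k) * sqrt (1 / \<rho>))\<^sup>2 * inv_form (?T k) (x k) (x k)"
      by (simp add: y_def z_def inv_form_def blinfun.scaleR_right power2_eq_square del: real_sqrt_divide)
    also have "(sqrt (s k) * sqrt (1 / \<rho>))\<^sup>2 = s k * (1 / \<rho>)"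
      using \<rho> s by (simp only: power_mult_distrib real_sqrt_pow2 zero_le_divide_1_iff less_imp_le)
    finally show ?thesis using \<rho> by simp
  qed
  finally have key: "inv_form (id_blinfun + (\<Sum>i<k. rank_one (y i))) (y k) (y k) = s k * inv_form (?T k) (x k) (x k)" for k .
  have pos: "1 + s k * inv_form (?T k) (x k) (x k) > 0" for k
    using s by (intro add_pos_nonneg mult_nonneg_nonneg inv_form_nonneg T) auto
  have "(\<Sum>k<n. ln (1 + s k * inv_form (?T k) (x k) (x k))) = ln (\<Prod>k<n. 1 + s k * inv_form (?T k) (x k) (x k))"
    using pos by (subst ln_prod) (auto simp: less_imp_neq[THEN not_sym])
  also have "(\<Prod>k<n. 1 + s k * inv_form (?T k) (x k) (x k)) = fredholm_det_plus_id (\<Sum>i<n. rank_one (y i))"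
    unfolding fredholm_det_plus_id_rank_one gram_det_eq_prod key ..
  also have "ln \<dots> \<le> ln (fredholm_det_plus_id (\<Sum>i<n. rank_one (z i)))"
    using fredholm_det_rank_one_mono[of "{..<n}" "\<lambda>i. sqrt (s i)" z] s
      fredholm_det_plus_rank_one(1)[of "{..<n}" y] fredholm_det_plus_rank_one(1)[of "{..<n}" z]
    by (subst ln_le_cancel_iff) (auto simp: y_def)
  also have "(\<Sum>i<n. rank_one (z i)) = (1 / \<rho>) *\<^sub>R (\<Sum>i<n. rank_one (x i))"
    by (simp only: z scaleR_sum_right)
  finally show ?thesis by (simp add: info_gain_def)
qed

section \<open>Measurability\<close>

lemma dense_range_le:
  fixes f :: "'a::topological_space \<Rightarrow> real"
  assumes d: "closure (range d) = UNIV" and f: "continuous_on UNIV f" and le: "\<And>i. f (d i) \<le> c"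
  shows "f x \<le> c"
proof -
  have "closed {x. f x \<le> c}" by (intro closed_Collect_le f continuous_on_const)
  then have "closure (range d) \<subseteq> {x. f x \<le> c}" using le by (intro closure_minimal) auto
  then show ?thesis using d by blast
qed

text \<open>Both quantifiers become countable: constants \<open>1 / (k + 1)\<close> suffice by the
  Archimedean property, and the inequality extends from a dense sequence by continuity.\<close>

lemma coercive_op_iff_dense:
  assumes d: "closure (range d) = UNIV" and T: "symmetric_op T"
  shows "coercive_op T \<longleftrightarrow> (\<exists>k::nat. \<forall>i. (1 / real (Suc k)) * (d i \<bullet> d i) \<le> d i \<bullet> blinfun_apply T (d i))"
proof
  assume "coercive_op T"
  then obtain c where c: "c > 0" "\<And>x. c * (x \<bullet> x) \<le> x \<bullet> blinfun_apply T x"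
    unfolding coercive_op_def by blast
  obtain k where "inverse (real (Suc k)) < c" using reals_Archimedean[OF c(1)] by blast
  then have "(1 / real (Suc k)) * (x \<bullet> x) \<le> c * (x \<bullet> x)" for x :: 'a
    by (intro mult_right_mono) (auto simp: inverse_eq_divide)
  then show "\<exists>k::nat. \<forall>i. (1 / real (Suc k)) * (d i \<bullet> d i) \<le> d i \<bullet> blinfun_apply T (d i)"
    using c(2) by (meson order_trans)
next
  assume "\<exists>k::nat. \<forall>i. (1 / real (Suc k)) * (d i \<bullet> d i) \<le> d i \<bullet> blinfun_apply T (d i)"
  then obtain k :: nat where k: "\<And>i. (1 / real (Suc k)) * (d i \<bullet> d i) \<le> d i \<bullet> blinfun_apply T (d i)"
    by blast
  define c where "c = 1 / real (Suc k)"
  have "c * (x \<bullet> x) - x \<bullet> blinfun_apply T x \<le> 0" for x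
    by (rule dense_range_le[OF d]) (use k in \<open>auto simp: c_def intro!: continuous_intros\<close>)
  moreover have "c > 0" by (simp add: c_def)
  ultimately have "c > 0 \<and> (\<forall>x. c * (x \<bullet> x) \<le> x \<bullet> blinfun_apply T x)"
    by (meson diff_le_0_iff_le)
  then show "coercive_op T" using T unfolding coercive_op_def by blast
qed

text \<open>This replaces the inverse, itself picked by \<open>SOME\<close>, by a countable supremum
  in which only the quadratic form of \<open>T\<close> occurs.\<close>

lemma inv_form_eq_SUP_dense:
  fixes T :: "'a::{real_inner,banach} \<Rightarrow>\<^sub>L 'a"
  assumes d: "closure (range d) = UNIV" and T: "coercive_op T"
  shows "bdd_above (range (\<lambda>i. 2 * (d i \<bullet> v) - d i \<bullet> blinfun_apply T (d i)))"
    and "inv_form T v v = (SUP i. 2 * (d i \<bullet> v) - d i \<bullet> blinfun_apply T (d i))"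
proof -
  let ?h = "\<lambda>x. 2 * (x \<bullet> v) - x \<bullet> blinfun_apply T x"
  have upper: "?h x \<le> inv_form T v v" for x by (rule inv_form_variational(1)[OF T])
  then show bdd: "bdd_above (range (\<lambda>i. ?h (d i)))" by (auto simp: bdd_above_def)
  have "?h x \<le> (SUP i. ?h (d i))" for x
    by (rule dense_range_le[OF d]) (auto intro!: continuous_intros cSUP_upper[OF _ bdd])
  from this[of "blinfun_apply (op_inverse T) v"] have "inv_form T v v \<le> (SUP i. ?h (d i))"
    unfolding inv_form_variational(2)[OF T] .
  moreover have "(SUP i. ?h (d i)) \<le> inv_form T v v"
    by (rule cSUP_least) (auto intro: upper)
  ultimately show "inv_form T v v = (SUP i. ?h (d i))" by (rule antisym)
qed

lemma sets_coercive_op: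
  fixes T :: "'w \<Rightarrow> ('a::{real_inner,second_countable_topology} \<Rightarrow>\<^sub>L 'a)"
  assumes T: "\<And>\<omega>. \<omega> \<in> space M \<Longrightarrow> symmetric_op (T \<omega>)"
    and [measurable]: "\<And>x. (\<lambda>\<omega>. x \<bullet> blinfun_apply (T \<omega>) x) \<in> borel_measurable M"
  shows "{\<omega> \<in> space M. coercive_op (T \<omega>)} \<in> sets M"
proof -
  obtain d :: "nat \<Rightarrow> 'a" where d: "closure (range d) = UNIV" by (rule dense_sequence_exists)
  have "{\<omega> \<in> space M. coercive_op (T \<omega>)}
      = {\<omega> \<in> space M. \<exists>k::nat. \<forall>i. (1 / real (Suc k)) * (d i \<bullet> d i) \<le> d i \<bullet> blinfun_apply (T \<omega>) (d i)}"
    using coercive_op_iff_dense[OF d T] by blast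
  also have "\<dots> \<in> sets M" by measurable
  finally show ?thesis .
qed

lemma borel_measurable_inv_form_diag:
  fixes T :: "'w \<Rightarrow> ('a::{real_inner,banach,second_countable_topology} \<Rightarrow>\<^sub>L 'a)"
  assumes T: "\<And>\<omega>. \<omega> \<in> space M \<Longrightarrow> coercive_op (T \<omega>)"
    and [measurable]: "\<And>x. (\<lambda>\<omega>. x \<bullet> blinfun_apply (T \<omega>) x) \<in> borel_measurable M"
      "v \<in> borel_measurable M"
  shows "(\<lambda>\<omega>. inv_form (T \<omega>) (v \<omega>) (v \<omega>)) \<in> borel_measurable M"
proof -
  obtain d :: "nat \<Rightarrow> 'a" where d: "closure (range d) = UNIV" by (rule dense_sequence_exists)
  have "(\<lambda>\<omega>. SUP i. 2 * (d i \<bullet> v \<omega>) - d i \<bullet> blinfun_apply (T \<omega>) (d i)) \<in> borel_measurable M"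
    using inv_form_eq_SUP_dense(1)[OF d T] by (intro borel_measurable_cSUP) auto
  then show ?thesis
    by (rule measurable_cong[THEN iffD1, rotated]) (simp add: inv_form_eq_SUP_dense(2)[OF d T])
qed

lemma borel_measurable_inv_form:
  fixes T :: "'w \<Rightarrow> ('a::{real_inner,banach,second_countable_topology} \<Rightarrow>\<^sub>L 'a)"
  assumes T: "\<And>\<omega>. \<omega> \<in> space M \<Longrightarrow> coercive_op (T \<omega>)"
    and q: "\<And>x. (\<lambda>\<omega>. x \<bullet> blinfun_apply (T \<omega>) x) \<in> borel_measurable M"
    and [measurable]: "u \<in> borel_measurable M" "v \<in> borel_measurable M"
  shows "(\<lambda>\<omega>. inv_form (T \<omega>) (u \<omega>) (v \<omega>)) \<in> borel_measurable M"
proof -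
  note diag = borel_measurable_inv_form_diag[OF T q]
  have "(\<lambda>\<omega>. (inv_form (T \<omega>) (u \<omega> + v \<omega>) (u \<omega> + v \<omega>) - inv_form (T \<omega>) (u \<omega> - v \<omega>) (u \<omega> - v \<omega>)) / 4)
      \<in> borel_measurable M"
    by (intro borel_measurable_divide borel_measurable_diff diag) measurable
  then show ?thesis
    by (rule measurable_cong[THEN iffD1, rotated]) (simp add: inv_form_polarization[OF T, symmetric])
qed

text \<open>Only symmetry is assumed, since a version of the conditional variance may be negative on
  a null set. The coercive outcomes form a measurable set; on the others the operator is the
  constant \<open>C\<close>.\<close>

lemma borel_measurable_norm_inv_sqrt_op:
  fixes T :: "'w \<Rightarrow> ('a::{real_inner,banach,second_countable_topology} \<Rightarrow>\<^sub>L 'a)"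
  assumes T: "\<And>\<omega>. \<omega> \<in> space M \<Longrightarrow> symmetric_op (T \<omega>)"
    and q: "\<And>x. (\<lambda>\<omega>. x \<bullet> blinfun_apply (T \<omega>) x) \<in> borel_measurable M"
    and [measurable]: "v \<in> borel_measurable M"
  shows "(\<lambda>\<omega>. norm (blinfun_apply (inv_sqrt_op (T \<omega>)) (v \<omega>))) \<in> borel_measurable M"
proof -
  have [measurable]: "{\<omega> \<in> space M. coercive_op (T \<omega>)} \<in> sets M"
    by (rule sets_coercive_op[OF T q])
  define T' where "T' \<omega> = (if coercive_op (T \<omega>) then T \<omega> else id_blinfun)" for \<omega>
  have T': "coercive_op (T' \<omega>)" for \<omega>
    using coercive_op_scaleR_id[of 1] by (auto simp: T'_def)
  have "(\<lambda>\<omega>. x \<bullet> blinfun_apply (T' \<omega>) x) \<in> borel_measurable M" for x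
  proof -
    have [measurable]: "(\<lambda>\<omega>. x \<bullet> blinfun_apply (T \<omega>) x) \<in> borel_measurable M" by (rule q)
    have "(\<lambda>\<omega>. if coercive_op (T \<omega>) then x \<bullet> blinfun_apply (T \<omega>) x else x \<bullet> x) \<in> borel_measurable M"
      by measurable
    then show ?thesis
      by (rule measurable_cong[THEN iffD1, rotated]) (simp add: T'_def)
  qed
  then have [measurable]: "(\<lambda>\<omega>. inv_form (T' \<omega>) (v \<omega>) (v \<omega>)) \<in> borel_measurable M"
    by (intro borel_measurable_inv_form_diag T') auto
  define C :: "'a \<Rightarrow>\<^sub>L 'a" where "C = (THE S. False)"
  have "(\<lambda>\<omega>. if coercive_op (T \<omega>) then sqrt (inv_form (T' \<omega>) (v \<omega>) (v \<omega>))
      else norm (blinfun_apply C (v \<omega>))) \<in> borel_measurable M"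
  proof (rule measurable_If)
    have "continuous_on UNIV (\<lambda>u. norm (blinfun_apply C u))" by (intro continuous_intros)
    then have "(\<lambda>u. norm (blinfun_apply C u)) \<in> borel_measurable borel"
      by (rule borel_measurable_continuous_onI)
    then show "(\<lambda>\<omega>. norm (blinfun_apply C (v \<omega>))) \<in> borel_measurable M"
      by (rule measurable_compose[rotated]) measurable
    show "{\<omega> \<in> space M. coercive_op (T \<omega>)} \<in> sets M" by (rule sets_coercive_op[OF T q])
  qed measurable
  then show ?thesis
    by (rule measurable_cong[THEN iffD1, rotated])
      (simp add: T'_def norm_inv_sqrt_op inv_sqrt_op_not_coercive[OF T] C_def)
qed

section \<open>The exponential increment\<close>

lemma exp_le_quadratic:
  fixes x :: real
  assumes "\<bar>x\<bar> \<le> 1"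
  shows "exp x \<le> 1 + x + x\<^sup>2"
proof (cases "0 \<le> x")
  case True
  then show ?thesis using assms by (intro exp_bound) auto
next
  case False
  let ?u = "- x"
  have u: "0 \<le> ?u" "?u \<le> 1" using False assms by auto
  \<comment> \<open>For negative \<open>x\<close> the claim is multiplied by
    \<open>exp (- x)\<close>, whose Taylor bound leaves only nonnegative powers of \<open>?u\<close>
    in the product.\<close>
  have "1 \<le> (1 + x + x\<^sup>2) * (1 + ?u + ?u\<^sup>2 / 2)"
  proof -
    have "(1 + x + x\<^sup>2) * (1 + ?u + ?u\<^sup>2 / 2) = 1 + ?u\<^sup>2 / 2 + ?u ^ 3 / 2 + ?u ^ 4 / 2"
      by (simp add: power2_eq_square power3_eq_cube power4_eq_xxxx field_simps)
    moreover have "0 \<le> ?u\<^sup>2" "0 \<le> ?u ^ 3" "0 \<le> ?u ^ 4" by (rule zero_le_power[OF u(1)])+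
    ultimately show ?thesis by linarith
  qed
  also have "\<dots> \<le> (1 + x + x\<^sup>2) * exp ?u"
  proof (rule mult_left_mono)
    show "1 + ?u + ?u\<^sup>2 / 2 \<le> exp ?u" by (rule exp_lower_Taylor_quadratic[OF u(1)])
    show "0 \<le> 1 + x + x\<^sup>2" using u by simp
  qed
  finally show ?thesis by (simp add: exp_minus field_simps)
qed

lemma ln_one_plus_ge:
  fixes z :: real
  assumes "0 \<le> z"
  shows "z / (1 + z) \<le> ln (1 + z)"
  using ln_le_minus_one[of "1 / (1 + z)"] assms by (simp add: ln_div field_simps)

text \<open>The square root linearises the recursion for the squared norm \<open>U\<close> at \<open>R = sqrt (U + \<rho>)\<close>.
  After division by \<open>R\<close> the martingale increment is bounded by \<open>1 / sqrt \<rho>\<close>, and the negative drift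
  \<open>- s m\<^sup>2\<close> dominates its conditional variance, independently of the size of \<open>U\<close>.\<close>

lemma exp_sqrt_increment:
  fixes \<rho> U m w s Y :: real
  assumes \<rho>: "1 \<le> \<rho>" and U: "0 \<le> U" and w: "0 \<le> w" "w \<le> 1 / \<rho>" and m: "m\<^sup>2 \<le> w * U"
    and s: "0 \<le> s" and Y: "\<bar>Y\<bar> \<le> 1"
    and U': "0 \<le> U + (2 * Y * m + Y\<^sup>2 * w - s * m\<^sup>2) / (1 + s * w)"
  defines "t \<equiv> sqrt \<rho> / 4 * m / ((1 + s * w) * sqrt (U + \<rho>))"
    and "v \<equiv> sqrt \<rho> / 8 * w / ((1 + s * w) * sqrt (U + \<rho>))"
  defines "b \<equiv> v + 2 * t\<^sup>2 + 2 * v\<^sup>2"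
  shows "\<bar>t\<bar> \<le> 1 / 4" "0 \<le> v" "v \<le> 1 / 8"
    and "exp (sqrt \<rho> / 4 * sqrt (U + (2 * Y * m + Y\<^sup>2 * w - s * m\<^sup>2) / (1 + s * w) + \<rho>) - ln (1 + s * w) / 4)
      \<le> exp (sqrt \<rho> / 4 * sqrt (U + \<rho>)) * ((1 + t * Y + b * Y\<^sup>2) * exp (- (b * s)))"
proof -
  define R where "R = sqrt (U + \<rho>)"
  define k where "k = 1 / (1 + s * w)"
  define r where "r = sqrt \<rho> / R"
  have R2: "R\<^sup>2 = U + \<rho>" using U \<rho> by (simp add: R_def)
  have R: "0 < R" using U \<rho> by (simp add: R_def add_nonneg_pos)
  have r: "0 < r" "r \<le> 1" using U \<rho> R by (auto simp: r_def R_def)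
  have sw: "0 \<le> s * w" using s w by simp
  have k: "0 < k" "k \<le> 1" using sw by (auto simp: k_def)
  have w1: "w \<le> 1" using w \<rho> by (auto intro: order_trans)
  have t: "t = r * m * k / 4" unfolding t_def r_def k_def R_def[symmetric] by simp
  have v: "v = r * w * k / 8" unfolding v_def r_def k_def R_def[symmetric] by simp
  \<comment> \<open>Cauchy-Schwarz and \<open>w \<le> 1 / \<rho>\<close> give
    \<open>\<rho> m^2 \<le> U\<close>, the only place where the size of \<open>m\<close> is
    controlled.\<close>
  have rm: "(r * m)\<^sup>2 \<le> 1"
  proof -
    have "\<rho> * m\<^sup>2 \<le> \<rho> * (w * U)" using m \<rho> by (intro mult_left_mono) auto
    also have "\<dots> = (\<rho> * w) * U" by simp
    also have "\<dots> \<le> 1 * U"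
      using w \<rho> U by (intro mult_right_mono) (auto simp: field_simps)
    also have "\<dots> \<le> R\<^sup>2" using \<rho> by (simp add: R2)
    finally show ?thesis
      using R \<rho> by (simp add: r_def power_mult_distrib power_divide field_simps)
  qed
  then have "\<bar>r * m\<bar> \<le> 1" by (simp add: abs_square_le_1)
  then have "\<bar>r * m\<bar> * k \<le> 1 * 1" using k by (intro mult_mono) auto
  then show t4: "\<bar>t\<bar> \<le> 1 / 4" using k by (simp add: t abs_mult)
  show v0: "0 \<le> v" using r w k by (simp add: v)
  have "r * w * k \<le> 1 * 1 * 1" using r w w1 k by (intro mult_mono) auto
  then show v8: "v \<le> 1 / 8" by (simp add: v)
  \<comment> \<open>The drift. Below, \<open>2 t^2 s\<close> equals \<open>r k d\<close>; with a
    factor larger than \<open>1 / 4\<close> in the exponent, \<open>r\<close> and \<open>k\<close>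
    near 1 would break the comparison.\<close>
  define d where "d = sqrt \<rho> / 8 * k * s * m\<^sup>2 / R"
  have d: "d = r * k * s * m\<^sup>2 / 8" by (simp add: d_def r_def)
  have "2 * t\<^sup>2 * s = (r * k) * d"
    by (simp add: t d power2_eq_square)
  also have "\<dots> \<le> 1 * d"
    using r k s by (intro mult_right_mono) (auto simp: d mult_le_one)
  finally have td: "2 * t\<^sup>2 * s \<le> d" by simp
  \<comment> \<open>As \<open>v \<le> 1 / 8\<close>, the left side is at most
    \<open>(5 / 4) v s\<close>, that is \<open>5 / 32\<close> of \<open>r s w k\<close>, and
    \<open>s w k = s w / (1 + s w)\<close> is at most the logarithm.\<close>
  have vl: "(v + 2 * v\<^sup>2) * s \<le> ln (1 + s * w) / 4"
  proof -
    have kl: "s * w * k \<le> ln (1 + s * w)"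
      using ln_one_plus_ge[OF sw] by (simp add: k_def)
    have "v * v \<le> 1 / 8 * v" using v0 v8 by (rule mult_right_mono[rotated])
    then have "(v + 2 * v\<^sup>2) * s \<le> (5 / 4 * v) * s"
      using s by (intro mult_right_mono) (auto simp: power2_eq_square)
    also have "\<dots> = 5 / 32 * (r * (s * w * k))" by (simp add: v)
    also have "\<dots> \<le> 1 / 4 * (1 * (s * w * k))"
      using r sw k s w by (intro mult_mono) auto
    also have "\<dots> \<le> ln (1 + s * w) / 4"
      using kl by simp
    finally show ?thesis .
  qed
  have bs: "b * s \<le> d + ln (1 + s * w) / 4"
    using td vl by (simp add: b_def algebra_simps)
  \<comment> \<open>The linearised exponent without the drift. Its square is at most
    \<open>2 (t Y)^2 + 2 (v Y^2)^2\<close>, and \<open>Y^4 \<le> Y^2\<close>, which explains the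
    three terms of \<open>b\<close>.\<close>
  define x where "x = t * Y + v * Y\<^sup>2"
  have Y2: "Y\<^sup>2 \<le> 1" using Y by (simp add: abs_square_le_1)
  have "\<bar>t * Y\<bar> \<le> 1 / 4 * 1" unfolding abs_mult using t4 Y by (intro mult_mono) auto
  moreover have "\<bar>v * Y\<^sup>2\<bar> \<le> 1 / 8 * 1" unfolding abs_mult using v0 v8 Y2 by (intro mult_mono) auto
  ultimately have "\<bar>x\<bar> \<le> 1" unfolding x_def by linarith
  then have "exp x \<le> 1 + x + x\<^sup>2" by (rule exp_le_quadratic)
  also have "x\<^sup>2 \<le> 2 * (t * Y)\<^sup>2 + 2 * (v * Y\<^sup>2)\<^sup>2"
    using zero_le_power2[of "t * Y - v * Y\<^sup>2"] by (simp add: x_def power2_eq_square algebra_simps)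
  also have "(v * Y\<^sup>2)\<^sup>2 \<le> v\<^sup>2 * Y\<^sup>2"
    using mult_left_mono[OF mult_right_mono[OF Y2, of "Y\<^sup>2"], of "v\<^sup>2"]
    by (simp add: power2_eq_square mult_ac)
  finally have ex: "exp x \<le> 1 + t * Y + b * Y\<^sup>2"
    by (simp add: x_def b_def power_mult_distrib algebra_simps)
  let ?Z = "U + (2 * Y * m + Y\<^sup>2 * w - s * m\<^sup>2) / (1 + s * w) + \<rho>"
  have Z: "0 \<le> ?Z" using U' \<rho> by simp
  \<comment> \<open>Concavity: the square root lies below its tangent at \<open>R^2\<close>, so the
    linearisation has no remainder to estimate.\<close>
  have "2 * sqrt ?Z * R \<le> ?Z + R\<^sup>2"
    using zero_le_power2[of "sqrt ?Z - R"] Z by (simp add: power2_diff)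
  then have "sqrt ?Z \<le> (?Z + R\<^sup>2) / (2 * R)" using R by (simp add: field_simps)
  also have "\<dots> = R + (2 * Y * m + Y\<^sup>2 * w - s * m\<^sup>2) * k / (2 * R)"
  proof -
    define e where "e = (2 * Y * m + Y\<^sup>2 * w - s * m\<^sup>2) * k"
    have "?Z = R\<^sup>2 + e" by (simp add: R2 e_def k_def)
    then show ?thesis
      using R unfolding e_def[symmetric] by (simp add: power2_eq_square field_simps)
  qed
  finally have "sqrt \<rho> / 4 * sqrt ?Z \<le> sqrt \<rho> / 4 * (R + (2 * Y * m + Y\<^sup>2 * w - s * m\<^sup>2) * k / (2 * R))"
    using \<rho> by (intro mult_left_mono) auto
  also have "\<dots> = sqrt \<rho> / 4 * R + x - d"
    using R by (simp add: x_def t v d r_def field_simps)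
  finally have "sqrt \<rho> / 4 * sqrt ?Z - ln (1 + s * w) / 4 \<le> sqrt \<rho> / 4 * R + (x + - (b * s))"
    using bs by simp
  then have "exp (sqrt \<rho> / 4 * sqrt ?Z - ln (1 + s * w) / 4) \<le> exp (sqrt \<rho> / 4 * R) * (exp x * exp (- (b * s)))"
    by (metis exp_add exp_le_cancel_iff)
  also have "\<dots> \<le> exp (sqrt \<rho> / 4 * R) * ((1 + t * Y + b * Y\<^sup>2) * exp (- (b * s)))"
    using ex by (intro mult_left_mono mult_right_mono) auto
  finally show "exp (sqrt \<rho> / 4 * sqrt ?Z - ln (1 + s * w) / 4)
      \<le> exp (sqrt \<rho> / 4 * sqrt (U + \<rho>)) * ((1 + t * Y + b * Y\<^sup>2) * exp (- (b * s)))"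
    unfolding R_def .
qed

section \<open>A maximal inequality\<close>

text \<open>No stopping time is needed. \<open>H n\<close> is the event that level \<open>a\<close>
  is reached by time \<open>n\<close>, and the invariant \<open>main\<close> charges
  \<open>a\<close> for outcomes in \<open>H n\<close> and \<open>L n\<close> for the rest: an
  outcome that newly reaches the level exchanges a value of at least \<open>a\<close> for
  \<open>a\<close>. The supermartingale property is tested on sets of \<open>F n\<close>, the form
  in which it is proved later.\<close>

lemma (in prob_space) supermartingale_maximal_inequality:
  fixes L :: "nat \<Rightarrow> 'a \<Rightarrow> real"
  assumes F: "filtration (space M) F" "\<And>n. subalgebra M (F n)"
    and adapted: "\<And>n. L n \<in> borel_measurable (F n)"
    and int: "\<And>n. integrable M (L n)" and nonneg: "\<And>n \<omega>. 0 \<le> L n \<omega>"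
    and super: "\<And>n A. A \<in> sets (F n) \<Longrightarrow> (\<integral>\<omega>. L (Suc n) \<omega> * indicator A \<omega> \<partial>M) \<le> (\<integral>\<omega>. L n \<omega> * indicator A \<omega> \<partial>M)"
    and a: "0 < a"
  shows "prob {\<omega> \<in> space M. \<exists>n. a \<le> L n \<omega>} \<le> expectation (L 0) / a"
proof -
  define H where "H n = {\<omega> \<in> space M. \<exists>i\<le>n. a \<le> L i \<omega>}" for n
  have sp: "space (F n) = space M" for n using F(2) by (simp add: subalgebra_def)
  have FM: "sets (F n) \<subseteq> sets M" for n using F(2) by (simp add: subalgebra_def)
  have Fm: "L i \<in> borel_measurable (F n)" if "i \<le> n" for i n
    using adapted[of i] filtration.sets_F_mono[OF F(1) that] by (auto simp: measurable_def sp)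
  have HF: "H n \<in> sets (F n)" for n
  proof -
    have "H n = (\<Union>i\<le>n. {\<omega> \<in> space (F n). a \<le> L i \<omega>})" by (auto simp: H_def sp)
    also have "\<dots> \<in> sets (F n)"
      using Fm by (intro sets.finite_UN) (auto intro: borel_measurable_le)
    finally show ?thesis .
  qed
  then have HM [measurable]: "H n \<in> sets M" for n using FM by blast
  have intA: "integrable M (\<lambda>\<omega>. L n \<omega> * indicator A \<omega>)" if "A \<in> sets M" for n A
    using integrable_real_mult_indicator[OF that int] .
  have intH: "integrable M (indicat_real (H n))" for n
    by (intro integrable_real_indicator) (auto simp: emeasure_eq_measure)
  have main: "(\<integral>\<omega>. L n \<omega> * indicator (space M - H n) \<omega> \<partial>M) + a * prob (H n) \<le> expectation (L 0)" for n
  proof (induction n)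
    case 0
    have "(\<integral>\<omega>. L 0 \<omega> * indicator (space M - H 0) \<omega> \<partial>M) + a * prob (H 0)
        = (\<integral>\<omega>. L 0 \<omega> * indicator (space M - H 0) \<omega> + a * indicator (H 0) \<omega> \<partial>M)"
      by (subst Bochner_Integration.integral_add) (auto intro!: intA simp: intH)
    also have "\<dots> \<le> (\<integral>\<omega>. L 0 \<omega> \<partial>M)"
    proof (rule integral_mono)
      fix \<omega> assume "\<omega> \<in> space M"
      then show "L 0 \<omega> * indicator (space M - H 0) \<omega> + a * indicator (H 0) \<omega> \<le> L 0 \<omega>"
        by (auto simp: H_def indicator_def)
    qed (auto intro!: intA int Bochner_Integration.integrable_add simp: intH)
    finally show ?case .
  next
    case (Suc n)
    have sub: "H n \<subseteq> H (Suc n)" by (auto simp: H_def le_Suc_eq)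
    have "(\<integral>\<omega>. L (Suc n) \<omega> * indicator (space M - H (Suc n)) \<omega> \<partial>M) + a * prob (H (Suc n))
        = (\<integral>\<omega>. L (Suc n) \<omega> * indicator (space M - H (Suc n)) \<omega> + a * indicator (H (Suc n)) \<omega> \<partial>M)"
      by (subst Bochner_Integration.integral_add) (auto intro!: intA simp: intH)
    also have "\<dots> \<le> (\<integral>\<omega>. L (Suc n) \<omega> * indicator (space M - H n) \<omega> + a * indicator (H n) \<omega> \<partial>M)"
    proof (rule integral_mono)
      fix \<omega> assume "\<omega> \<in> space M"
      then show "L (Suc n) \<omega> * indicator (space M - H (Suc n)) \<omega> + a * indicator (H (Suc n)) \<omega>
          \<le> L (Suc n) \<omega> * indicator (space M - H n) \<omega> + a * indicator (H n) \<omega>"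
        using sub by (auto simp: H_def indicator_def le_Suc_eq)
    qed (auto intro!: intA Bochner_Integration.integrable_add simp: intH)
    also have "\<dots> = (\<integral>\<omega>. L (Suc n) \<omega> * indicator (space M - H n) \<omega> \<partial>M) + a * prob (H n)"
      by (subst Bochner_Integration.integral_add) (auto intro!: intA simp: intH)
    also have "\<dots> \<le> (\<integral>\<omega>. L n \<omega> * indicator (space M - H n) \<omega> \<partial>M) + a * prob (H n)"
      using super[of "space M - H n" n] HF[of n] sets.compl_sets[of "H n" "F n"] by (simp add: sp)
    also have "\<dots> \<le> expectation (L 0)" by (rule Suc)
    finally show ?case .
  qed
  have "prob (H n) \<le> expectation (L 0) / a" for n
  proof -
    have "0 \<le> (\<integral>\<omega>. L n \<omega> * indicator (space M - H n) \<omega> \<partial>M)"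
      using nonneg by (intro Bochner_Integration.integral_nonneg) auto
    with main[of n] a show ?thesis by (simp add: field_simps)
  qed
  moreover have "(\<lambda>n. prob (H n)) \<longlonglongrightarrow> prob (\<Union>n. H n)"
  proof (rule finite_Lim_measure_incseq)
    show "range H \<subseteq> sets M" using HM by blast
    show "incseq H" by (rule incseq_SucI) (auto simp: H_def le_Suc_eq)
  qed
  ultimately have "prob (\<Union>n. H n) \<le> expectation (L 0) / a"
    by (intro LIMSEQ_le_const2) auto
  moreover have "(\<Union>n. H n) = {\<omega> \<in> space M. \<exists>n. a \<le> L n \<omega>}" by (auto simp: H_def)
  ultimately show ?thesis by simp
qed

section \<open>The exponential supermartingale\<close>

text \<open>The increments are indexed from \<open>0\<close>, so that \<open>X n\<close> and the conditional variance \<open>s n\<close> of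
  \<open>Y n\<close> are measurable with respect to \<open>F n\<close>, and \<open>Y n\<close> with respect to \<open>F (Suc n)\<close>.\<close>

locale bounded_increments = prob_space P for P :: "'w measure" +
  fixes F :: "nat \<Rightarrow> 'w measure"
    and X :: "nat \<Rightarrow> 'w \<Rightarrow> 'a::{real_inner,banach,second_countable_topology}"
    and Y s :: "nat \<Rightarrow> 'w \<Rightarrow> real" and \<rho> :: real
  assumes filt: "filtration (space P) F" and subalg: "\<And>n. subalgebra P (F n)"
    and X_meas: "\<And>n. X n \<in> borel_measurable (F n)"
    and X_le: "\<And>n \<omega>. \<omega> \<in> space P \<Longrightarrow> norm (X n \<omega>) \<le> 1"
    and Y_meas: "\<And>n. Y n \<in> borel_measurable (F (Suc n))"
    and Y_le: "\<And>n \<omega>. \<bar>Y n \<omega>\<bar> \<le> 1"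
    and s_meas: "\<And>n. s n \<in> borel_measurable (F n)"
    and s_ge: "\<And>n \<omega>. 0 \<le> s n \<omega>"
    and s_le: "\<And>n \<omega>. s n \<omega> \<le> 1"
    and mean_zero: "\<And>n \<phi> B. \<phi> \<in> borel_measurable (F n) \<Longrightarrow> (\<And>\<omega>. \<omega> \<in> space P \<Longrightarrow> \<bar>\<phi> \<omega>\<bar> \<le> B)
      \<Longrightarrow> (\<integral>\<omega>. \<phi> \<omega> * Y n \<omega> \<partial>P) = 0"
    and cond_variance: "\<And>n \<phi> B. \<phi> \<in> borel_measurable (F n) \<Longrightarrow> (\<And>\<omega>. \<omega> \<in> space P \<Longrightarrow> \<bar>\<phi> \<omega>\<bar> \<le> B)
      \<Longrightarrow> (\<integral>\<omega>. \<phi> \<omega> * (Y n \<omega>)\<^sup>2 \<partial>P) = (\<integral>\<omega>. \<phi> \<omega> * s n \<omega> \<partial>P)"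
    and \<rho>_ge: "1 \<le> \<rho>"
begin

definition M :: "nat \<Rightarrow> 'w \<Rightarrow> 'a" where
  "M n \<omega> = (\<Sum>i<n. Y i \<omega> *\<^sub>R X i \<omega>)"

definition T :: "nat \<Rightarrow> 'w \<Rightarrow> ('a \<Rightarrow>\<^sub>L 'a)" where
  "T n \<omega> = \<rho> *\<^sub>R id_blinfun + (\<Sum>i<n. s i \<omega> *\<^sub>R rank_one (X i \<omega>))"

definition U :: "nat \<Rightarrow> 'w \<Rightarrow> real" where
  "U n \<omega> = inv_form (T n \<omega>) (M n \<omega>) (M n \<omega>)"

definition m :: "nat \<Rightarrow> 'w \<Rightarrow> real" where
  "m n \<omega> = inv_form (T n \<omega>) (X n \<omega>) (M n \<omega>)"

definition w :: "nat \<Rightarrow> 'w \<Rightarrow> real" where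
  "w n \<omega> = inv_form (T n \<omega>) (X n \<omega>) (X n \<omega>)"

definition L :: "nat \<Rightarrow> 'w \<Rightarrow> real" where
  "L n \<omega> = exp (sqrt \<rho> / 4 * sqrt (U n \<omega> + \<rho>) - (\<Sum>k<n. ln (1 + s k \<omega> * w k \<omega>)) / 4)"

lemma coercive_T: "coercive_op (T n \<omega>)"
  unfolding T_def using \<rho>_ge s_ge by (intro coercive_op_plus_sum_rank_one coercive_op_scaleR_id) auto

lemma T_ge: "\<rho> * (x \<bullet> x) \<le> x \<bullet> blinfun_apply (T n \<omega>) x"
  by (simp add: T_def blinfun.add_left blinfun.scaleR_left blinfun.sum_left inner_add_right
      inner_sum_right inner_rank_one sum_nonneg s_ge)

lemma U_nonneg: "0 \<le> U n \<omega>" and w_nonneg: "0 \<le> w n \<omega>"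
  unfolding U_def w_def by (rule inv_form_nonneg[OF coercive_T])+

lemma w_le: "\<omega> \<in> space P \<Longrightarrow> w n \<omega> \<le> 1 / \<rho>"
  using inv_form_le[OF coercive_T[of n \<omega>] _ T_ge, where u = "X n \<omega>"] \<rho>_ge X_le[of \<omega> n]
  by (auto simp: w_def dot_square_norm power_le_one elim!: order_trans intro!: divide_right_mono)

lemma m_le: "(m n \<omega>)\<^sup>2 \<le> w n \<omega> * U n \<omega>"
  unfolding m_def w_def U_def by (rule inv_form_Cauchy_Schwarz[OF coercive_T])

lemma U_Suc:
  "U (Suc n) \<omega> = U n \<omega> + (2 * Y n \<omega> * m n \<omega> + (Y n \<omega>)\<^sup>2 * w n \<omega> - s n \<omega> * (m n \<omega>)\<^sup>2) / (1 + s n \<omega> * w n \<omega>)"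
proof -
  note commute = inv_form_commute[OF coercive_T, of n \<omega> "M n \<omega>" "X n \<omega>"]
  have TS: "T (Suc n) \<omega> = T n \<omega> + s n \<omega> *\<^sub>R rank_one (X n \<omega>)"
    and MS: "M (Suc n) \<omega> = M n \<omega> + Y n \<omega> *\<^sub>R X n \<omega>"
    by (simp_all add: T_def M_def add.assoc)
  have 1: "inv_form (T n \<omega>) (M (Suc n) \<omega>) (M (Suc n) \<omega>) = U n \<omega> + 2 * Y n \<omega> * m n \<omega> + (Y n \<omega>)\<^sup>2 * w n \<omega>"
    using commute unfolding MS U_def m_def w_def inv_form_def
    by (simp add: blinfun.bilinear_simps inner_add_left inner_add_right power2_eq_square algebra_simps)
  have 2: "inv_form (T n \<omega>) (M (Suc n) \<omega>) (X n \<omega>) = m n \<omega> + Y n \<omega> * w n \<omega>"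
    using commute unfolding MS m_def w_def inv_form_def
    by (simp add: inner_add_left)
  have 3: "inv_form (T n \<omega>) (X n \<omega>) (M (Suc n) \<omega>) = m n \<omega> + Y n \<omega> * w n \<omega>"
    unfolding MS m_def w_def inv_form_def
    by (simp add: blinfun.bilinear_simps inner_add_right)
  have pos: "1 + s n \<omega> * w n \<omega> > 0" using s_ge w_nonneg by (simp add: add_pos_nonneg)
  have "U (Suc n) \<omega> = U n \<omega> + 2 * Y n \<omega> * m n \<omega> + (Y n \<omega>)\<^sup>2 * w n \<omega>
      - s n \<omega> * (m n \<omega> + Y n \<omega> * w n \<omega>)\<^sup>2 / (1 + s n \<omega> * w n \<omega>)"
    unfolding U_def[of "Suc n"] TS inv_form_plus_rank_one[OF coercive_T s_ge] 1 2 3 w_def[symmetric]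
    by (simp add: power2_eq_square)
  \<comment> \<open>Over the common denominator the terms \<open>2 s w Y m\<close> and
    \<open>s w^2 Y^2\<close> cancel.\<close>
  then show ?thesis
    using pos by (simp add: field_simps power2_eq_square)
qed

lemma F_mono: "i \<le> j \<Longrightarrow> f \<in> borel_measurable (F i) \<Longrightarrow> f \<in> borel_measurable (F j)"
  using filtration.sets_F_mono[OF filt, of i j] subalg[of i] subalg[of j]
  by (auto simp: measurable_def subalgebra_def)

lemma F_P: "f \<in> borel_measurable (F i) \<Longrightarrow> f \<in> borel_measurable P"
  by (rule measurable_from_subalg[OF subalg])

lemma space_F: "space (F i) = space P"
  using subalg by (simp add: subalgebra_def)

lemma M_meas: "M n \<in> borel_measurable (F n)"
  unfolding M_def
  by (intro borel_measurable_sum borel_measurable_scaleR)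
    (auto intro: F_mono[OF _ X_meas] F_mono[OF _ Y_meas])

lemma T_meas: "(\<lambda>\<omega>. x \<bullet> blinfun_apply (T n \<omega>) x) \<in> borel_measurable (F n)"
proof -
  have [measurable]: "s i \<in> borel_measurable (F n)" "X i \<in> borel_measurable (F n)" if "i < n" for i
    using that by (auto intro: F_mono[OF _ X_meas] F_mono[OF _ s_meas])
  have "(\<lambda>\<omega>. \<rho> * (x \<bullet> x) + (\<Sum>i<n. s i \<omega> * (X i \<omega> \<bullet> x)\<^sup>2)) \<in> borel_measurable (F n)"
    by measurable
  then show ?thesis
    by (simp add: T_def blinfun.add_left blinfun.scaleR_left blinfun.sum_left inner_add_right
        inner_sum_right inner_rank_one)
qed

lemma
  shows U_meas: "U n \<in> borel_measurable (F n)"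
    and m_meas: "m n \<in> borel_measurable (F n)"
    and w_meas: "w n \<in> borel_measurable (F n)"
  using borel_measurable_inv_form[OF coercive_T T_meas] M_meas X_meas
  by (auto simp: U_def[abs_def] m_def[abs_def] w_def[abs_def])

lemma L_meas: "L n \<in> borel_measurable (F n)"
proof -
  have [measurable]: "s i \<in> borel_measurable (F n)" "w i \<in> borel_measurable (F n)" if "i < n" for i
    using that by (auto intro: F_mono[OF _ w_meas] F_mono[OF _ s_meas])
  have [measurable]: "U n \<in> borel_measurable (F n)" by (rule U_meas)
  show ?thesis unfolding L_def[abs_def] by measurable
qed

text \<open>The bound grows with \<open>n\<close>; it serves integrability and boundedness of test
  functions at each fixed time.\<close>

lemma L_bounded:
  obtains B where "\<And>\<omega>. \<omega> \<in> space P \<Longrightarrow> L n \<omega> \<le> B"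
proof
  fix \<omega> assume \<omega>: "\<omega> \<in> space P"
  have "norm (M n \<omega>) \<le> (\<Sum>i<n. norm (Y i \<omega> *\<^sub>R X i \<omega>))"
    unfolding M_def by (rule norm_sum)
  also have "\<dots> \<le> (\<Sum>i<n. 1)"
    using Y_le X_le[OF \<omega>] by (intro sum_mono) (simp add: mult_le_one)
  finally have "M n \<omega> \<bullet> M n \<omega> \<le> (real n)\<^sup>2"
    by (simp add: dot_square_norm power_mono)
  then have "U n \<omega> \<le> (real n)\<^sup>2 / \<rho>"
    using inv_form_le[OF coercive_T[of n \<omega>] _ T_ge, where u = "M n \<omega>"] \<rho>_ge
    by (auto simp: U_def elim!: order_trans intro!: divide_right_mono)
  moreover have "0 \<le> (\<Sum>k<n. ln (1 + s k \<omega> * w k \<omega>))"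
    using s_ge w_nonneg by (intro sum_nonneg ln_ge_zero) simp
  ultimately show "L n \<omega> \<le> exp (sqrt \<rho> / 4 * sqrt ((real n)\<^sup>2 / \<rho> + \<rho>))"
    using \<rho>_ge unfolding L_def
    by (intro exp_le_cancel_iff[THEN iffD2] diff_le_eq[THEN iffD2] add_increasing2 mult_left_mono) auto
qed

lemma integrable_bounded:
  assumes "f \<in> borel_measurable P" "\<And>\<omega>. \<omega> \<in> space P \<Longrightarrow> \<bar>f \<omega>\<bar> \<le> B"
  shows "integrable P (f :: 'w \<Rightarrow> real)"
  using assms by (intro integrable_const_bound[where B = B]) auto

lemma integrable_L: "integrable P (L n)"
proof -
  obtain B where "\<And>\<omega>. \<omega> \<in> space P \<Longrightarrow> L n \<omega> \<le> B" using L_bounded[of n] by blast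
  then show ?thesis
    by (intro integrable_bounded[where B = B] F_P[OF L_meas]) (simp add: L_def)
qed

text \<open>By \<open>exp_sqrt_increment\<close> the new value is at most
  \<open>L n (1 + t Y + b Y^2) exp (- b s)\<close>. Testing \<open>Y\<close> and \<open>Y^2\<close>
  against the bounded \<open>F n\<close>-measurable functions \<open>\<phi> t\<close> and
  \<open>\<phi> b\<close> turns the bracket into \<open>1 + b s\<close>, which is at most
  \<open>exp (b s)\<close>.\<close>

lemma L_supermartingale:
  assumes A: "A \<in> sets (F n)"
  shows "(\<integral>\<omega>. L (Suc n) \<omega> * indicator A \<omega> \<partial>P) \<le> (\<integral>\<omega>. L n \<omega> * indicator A \<omega> \<partial>P)"
proof -
  define t where "t \<omega> = sqrt \<rho> / 4 * m n \<omega> / ((1 + s n \<omega> * w n \<omega>) * sqrt (U n \<omega> + \<rho>))" for \<omega>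
  define v where "v \<omega> = sqrt \<rho> / 8 * w n \<omega> / ((1 + s n \<omega> * w n \<omega>) * sqrt (U n \<omega> + \<rho>))" for \<omega>
  define b where "b \<omega> = v \<omega> + 2 * (t \<omega>)\<^sup>2 + 2 * (v \<omega>)\<^sup>2" for \<omega>
  define \<phi> where "\<phi> \<omega> = L n \<omega> * indicator A \<omega> * exp (- (b \<omega> * s n \<omega>))" for \<omega>
  have [measurable]: "m n \<in> borel_measurable (F n)" "w n \<in> borel_measurable (F n)"
    "s n \<in> borel_measurable (F n)" "U n \<in> borel_measurable (F n)" "L n \<in> borel_measurable (F n)"
    by (rule m_meas w_meas s_meas U_meas L_meas)+
  note [measurable] = A
  have tF [measurable]: "t \<in> borel_measurable (F n)" unfolding t_def[abs_def] by measurable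
  have [measurable]: "v \<in> borel_measurable (F n)" unfolding v_def[abs_def] by measurable
  have bF [measurable]: "b \<in> borel_measurable (F n)" unfolding b_def[abs_def] by measurable
  have \<phi>F [measurable]: "\<phi> \<in> borel_measurable (F n)" unfolding \<phi>_def[abs_def] by measurable
  have AP: "A \<in> sets P" using A subalg[of n] by (auto simp: subalgebra_def)
  \<comment> \<open>The hypothesis that the updated value is nonnegative is \<open>U_nonneg\<close>
    at the next time, rewritten by the recursion.\<close>
  note step = exp_sqrt_increment[OF \<rho>_ge U_nonneg w_nonneg w_le m_le s_ge Y_le
      U_nonneg[of "Suc n", unfolded U_Suc], folded t_def v_def b_def]
  have t: "\<bar>t \<omega>\<bar> \<le> 1" if "\<omega> \<in> space P" for \<omega> using step(1)[OF that] by linarith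
  have b0: "0 \<le> b \<omega>" if "\<omega> \<in> space P" for \<omega> using step(2)[OF that] by (simp add: b_def)
  have b1: "b \<omega> \<le> 1" if "\<omega> \<in> space P" for \<omega>
  proof -
    have "(t \<omega>)\<^sup>2 \<le> (1 / 4)\<^sup>2" using step(1)[OF that] by (simp add: abs_le_square_iff[symmetric])
    moreover have "(v \<omega>)\<^sup>2 \<le> (1 / 8)\<^sup>2" using step(2,3)[OF that] by (intro power_mono)
    ultimately show ?thesis using step(3)[OF that] by (simp add: b_def power2_eq_square)
  qed
  obtain B where B: "\<And>\<omega>. \<omega> \<in> space P \<Longrightarrow> L n \<omega> \<le> B" using L_bounded[of n] by blast
  have \<phi>0: "0 \<le> \<phi> \<omega>" for \<omega> by (simp add: \<phi>_def L_def)
  have \<phi>B: "\<bar>\<phi> \<omega>\<bar> \<le> B" if "\<omega> \<in> space P" for \<omega>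
  proof -
    have "\<phi> \<omega> \<le> L n \<omega> * 1 * 1"
      unfolding \<phi>_def using b0[OF that] s_ge
      by (intro mult_mono) (auto simp: L_def indicator_def)
    then show ?thesis using B[OF that] \<phi>0[of \<omega>] by simp
  qed
  have prod: "\<bar>\<phi> \<omega> * u\<bar> \<le> B" if "\<omega> \<in> space P" "\<bar>u\<bar> \<le> 1" for \<omega> u
  proof -
    have "\<bar>\<phi> \<omega> * u\<bar> \<le> B * 1"
      unfolding abs_mult using \<phi>B[OF that(1)] that(2) by (intro mult_mono) auto
    then show ?thesis by simp
  qed
  have [measurable]: "\<phi> \<in> borel_measurable P" "t \<in> borel_measurable P" "b \<in> borel_measurable P"
    "s n \<in> borel_measurable P" "Y n \<in> borel_measurable P"
    by (rule F_P[OF \<phi>F] F_P[OF tF] F_P[OF bF] F_P[OF s_meas] F_P[OF Y_meas])+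
  have tY: "\<bar>t \<omega> * Y n \<omega>\<bar> \<le> 1" if "\<omega> \<in> space P" for \<omega>
    unfolding abs_mult using t[OF that] Y_le by (intro mult_le_one) auto
  have bY: "\<bar>b \<omega> * (Y n \<omega>)\<^sup>2\<bar> \<le> 1" if "\<omega> \<in> space P" for \<omega>
    unfolding abs_mult using b0[OF that] b1[OF that] Y_le by (intro mult_le_one) (auto simp: abs_square_le_1)
  have bs: "\<bar>b \<omega> * s n \<omega>\<bar> \<le> 1" if "\<omega> \<in> space P" for \<omega>
    unfolding abs_mult using b0[OF that] b1[OF that] s_ge[of n \<omega>] s_le[of n \<omega>] by (intro mult_le_one) auto
  have int: "integrable P \<phi>" "integrable P (\<lambda>\<omega>. \<phi> \<omega> * (t \<omega> * Y n \<omega>))"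
    "integrable P (\<lambda>\<omega>. \<phi> \<omega> * (b \<omega> * (Y n \<omega>)\<^sup>2))" "integrable P (\<lambda>\<omega>. \<phi> \<omega> * (b \<omega> * s n \<omega>))"
    by (rule integrable_bounded[where B = B]; use \<phi>B prod tY bY bs in simp)+
  have "(\<integral>\<omega>. L (Suc n) \<omega> * indicator A \<omega> \<partial>P)
      \<le> (\<integral>\<omega>. \<phi> \<omega> + \<phi> \<omega> * (t \<omega> * Y n \<omega>) + \<phi> \<omega> * (b \<omega> * (Y n \<omega>)\<^sup>2) \<partial>P)"
  proof (rule integral_mono)
    show "integrable P (\<lambda>\<omega>. L (Suc n) \<omega> * indicator A \<omega>)"
      using integrable_real_mult_indicator[OF AP integrable_L] .
    show "integrable P (\<lambda>\<omega>. \<phi> \<omega> + \<phi> \<omega> * (t \<omega> * Y n \<omega>) + \<phi> \<omega> * (b \<omega> * (Y n \<omega>)\<^sup>2))"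
      using int by simp
    fix \<omega> assume \<omega>: "\<omega> \<in> space P"
    let ?S = "(\<Sum>k<n. ln (1 + s k \<omega> * w k \<omega>)) / 4"
    have "L (Suc n) \<omega> = exp (sqrt \<rho> / 4 * sqrt (U (Suc n) \<omega> + \<rho>) - ln (1 + s n \<omega> * w n \<omega>) / 4) * exp (- ?S)"
      by (simp add: L_def add_divide_distrib flip: exp_add)
    also have "\<dots> \<le> exp (sqrt \<rho> / 4 * sqrt (U n \<omega> + \<rho>))
        * ((1 + t \<omega> * Y n \<omega> + b \<omega> * (Y n \<omega>)\<^sup>2) * exp (- (b \<omega> * s n \<omega>))) * exp (- ?S)"
      using step(4)[OF \<omega>] unfolding U_Suc by (intro mult_right_mono) auto
    also have "\<dots> = L n \<omega> * ((1 + t \<omega> * Y n \<omega> + b \<omega> * (Y n \<omega>)\<^sup>2) * exp (- (b \<omega> * s n \<omega>)))"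
    proof -
      have "L n \<omega> = exp (sqrt \<rho> / 4 * sqrt (U n \<omega> + \<rho>)) * exp (- ?S)"
        unfolding L_def by (simp flip: exp_add)
      then show ?thesis by (simp only: mult_ac)
    qed
    finally have "L (Suc n) \<omega> * indicator A \<omega>
        \<le> L n \<omega> * ((1 + t \<omega> * Y n \<omega> + b \<omega> * (Y n \<omega>)\<^sup>2) * exp (- (b \<omega> * s n \<omega>))) * indicator A \<omega>"
      by (rule mult_right_mono) simp
    then show "L (Suc n) \<omega> * indicator A \<omega> \<le> \<phi> \<omega> + \<phi> \<omega> * (t \<omega> * Y n \<omega>) + \<phi> \<omega> * (b \<omega> * (Y n \<omega>)\<^sup>2)"
      by (simp add: \<phi>_def algebra_simps)
  qed
  also have "\<dots> = (\<integral>\<omega>. \<phi> \<omega> \<partial>P) + (\<integral>\<omega>. (\<phi> \<omega> * t \<omega>) * Y n \<omega> \<partial>P) + (\<integral>\<omega>. (\<phi> \<omega> * b \<omega>) * (Y n \<omega>)\<^sup>2 \<partial>P)"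
    using int by (simp add: mult.assoc)
  also have "(\<integral>\<omega>. (\<phi> \<omega> * t \<omega>) * Y n \<omega> \<partial>P) = 0"
    by (rule mean_zero[where B = B]) (measurable, use prod t in auto)
  also have "(\<integral>\<omega>. (\<phi> \<omega> * b \<omega>) * (Y n \<omega>)\<^sup>2 \<partial>P) = (\<integral>\<omega>. (\<phi> \<omega> * b \<omega>) * s n \<omega> \<partial>P)"
    by (rule cond_variance[where B = B]) (measurable, use prod b0 b1 in auto)
  also have "(\<integral>\<omega>. \<phi> \<omega> \<partial>P) + 0 + (\<integral>\<omega>. (\<phi> \<omega> * b \<omega>) * s n \<omega> \<partial>P) = (\<integral>\<omega>. \<phi> \<omega> + \<phi> \<omega> * (b \<omega> * s n \<omega>) \<partial>P)"
    using int by (simp add: mult.assoc)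
  also have "\<dots> \<le> (\<integral>\<omega>. L n \<omega> * indicator A \<omega> \<partial>P)"
  proof (rule integral_mono)
    show "integrable P (\<lambda>\<omega>. \<phi> \<omega> + \<phi> \<omega> * (b \<omega> * s n \<omega>))" using int by simp
    show "integrable P (\<lambda>\<omega>. L n \<omega> * indicator A \<omega>)"
      using integrable_real_mult_indicator[OF AP integrable_L] .
    fix \<omega>
    have "\<phi> \<omega> + \<phi> \<omega> * (b \<omega> * s n \<omega>) = \<phi> \<omega> * (1 + b \<omega> * s n \<omega>)" by (simp add: algebra_simps)
    also have "\<dots> \<le> \<phi> \<omega> * exp (b \<omega> * s n \<omega>)"
      by (intro mult_left_mono exp_ge_add_one_self \<phi>0)
    also have "\<dots> = L n \<omega> * indicator A \<omega>" by (simp add: \<phi>_def exp_minus)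
    finally show "\<phi> \<omega> + \<phi> \<omega> * (b \<omega> * s n \<omega>) \<le> L n \<omega> * indicator A \<omega>" .
  qed
  finally show ?thesis .
qed

lemma self_normalised_tail:
  defines "G \<equiv> \<lambda>y. {\<omega> \<in> space P. \<exists>n. sqrt \<rho> / 4 * sqrt \<rho> + y + (\<Sum>k<n. ln (1 + s k \<omega> * w k \<omega>)) / 4
    \<le> sqrt \<rho> / 4 * sqrt (U n \<omega> + \<rho>)}"
  shows "G y \<in> sets P" "prob (G y) \<le> exp (- y)"
proof -
  \<comment> \<open>The constant initial value \<open>L 0\<close> times \<open>exp y\<close>, since
    \<open>M 0 = 0\<close>.\<close>
  let ?a = "exp (sqrt \<rho> / 4 * sqrt \<rho> + y)"
  have G: "G y = {\<omega> \<in> space P. \<exists>n. ?a \<le> L n \<omega>}"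
    unfolding G_def L_def exp_le_cancel_iff by (simp add: algebra_simps)
  have [measurable]: "L n \<in> borel_measurable P" for n by (rule F_P[OF L_meas])
  show "G y \<in> sets P" unfolding G by measurable
  have "prob (G y) \<le> expectation (L 0) / ?a"
    unfolding G
    by (rule supermartingale_maximal_inequality[OF filt subalg L_meas integrable_L _ L_supermartingale])
      (simp_all add: L_def)
  also have "L 0 = (\<lambda>_. exp (sqrt \<rho> / 4 * sqrt \<rho>))"
    by (simp add: L_def[abs_def] U_def M_def inv_form_def)
  also have "expectation (\<lambda>_. exp (sqrt \<rho> / 4 * sqrt \<rho>)) / ?a = exp (- y)"
    by (simp add: prob_space del: real_sqrt_mult_self flip: exp_diff)
  finally show "prob (G y) \<le> exp (- y)" .
qed

end

section \<open>The tail bound\<close>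

text \<open>The evaluated determinant is a polynomial in the inner products of the
  \<open>X i\<close>, so measurability of operators is avoided.\<close>

lemma borel_measurable_info_gain_gram:
  fixes X :: "nat \<Rightarrow> 'w \<Rightarrow> 'a::{real_inner,banach,second_countable_topology}"
  assumes X: "\<And>i. i < n \<Longrightarrow> X i \<in> borel_measurable M" and \<rho>: "\<rho> > 0"
  shows "(\<lambda>\<omega>. info_gain ((1 / \<rho>) *\<^sub>R (\<Sum>i<n. rank_one (X i \<omega>)))) \<in> borel_measurable M"
proof -
  have "(1 / \<rho>) *\<^sub>R (\<Sum>i<n. rank_one (X i \<omega>)) = (\<Sum>i<n. rank_one (sqrt (1 / \<rho>) *\<^sub>R X i \<omega>))" for \<omega>
    unfolding rank_one_scaleR scaleR_sum_right using \<rho> by (simp del: real_sqrt_divide)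
  moreover have "(\<lambda>\<omega>. det_plus_id n (\<lambda>i j. (sqrt (1 / \<rho>) *\<^sub>R X i \<omega>) \<bullet> (sqrt (1 / \<rho>) *\<^sub>R X j \<omega>))) \<in> borel_measurable M"
    unfolding det_plus_id_def det_mat_leibniz
  proof (intro borel_measurable_sum borel_measurable_times borel_measurable_const borel_measurable_prod
      borel_measurable_add borel_measurable_inner borel_measurable_scaleR)
    fix p i assume "p \<in> {p. p permutes {0..<n}}" "i \<in> {0..<n}"
    then have "p i < n" "i < n" by (auto simp: permutes_in_image)
    then show "X i \<in> borel_measurable M" "X (p i) \<in> borel_measurable M" by (auto intro: X)
  qed
  ultimately show ?thesis
    by (simp add: info_gain_def fredholm_det_plus_id_rank_one)
qed

theorem mainTheorem1:
  fixes P :: "'w measure"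
    and F :: "nat \<Rightarrow> 'w measure"
    and X :: "nat \<Rightarrow> 'w \<Rightarrow> 'a::{real_inner, banach, second_countable_topology}"
    and Y :: "nat \<Rightarrow> 'w \<Rightarrow> real"
    and \<rho> y :: real
  assumes "prob_space P"
    and "filtration (space P) F"
    and "\<And>n. subalgebra P (F n)"
    and "\<And>n. n \<ge> 1 \<Longrightarrow> X n \<in> borel_measurable (F (n - 1))"
    and "\<And>n \<omega>. n \<ge> 1 \<Longrightarrow> \<omega> \<in> space P \<Longrightarrow> X n \<omega> \<in> cball 0 1"
    and "\<And>n. n \<ge> 1 \<Longrightarrow> Y n \<in> borel_measurable (F n)"
    and "\<And>n. n \<ge> 1 \<Longrightarrow> AE \<omega> in P. real_cond_exp P (F (n - 1)) (Y n) \<omega> = 0"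
    and "\<And>n. n \<ge> 1 \<Longrightarrow> AE \<omega> in P. \<bar>Y n \<omega>\<bar> \<le> 1"
    and "\<rho> \<ge> 1"
    and "y > 0"
  defines "bad \<equiv> {\<omega> \<in> space P. \<exists>n\<ge>1.
      self_norm P F X Y \<rho> n \<omega>
        > sqrt \<rho>
          + (78 * info_gain ((1 / \<rho>) *\<^sub>R gram_op X n \<omega>) + 4 * y) / sqrt \<rho>
          + sqrt (18 * info_gain ((1 / \<rho>) *\<^sub>R gram_op X n \<omega>) + 6 * y)}"
  shows "bad \<in> sets P \<and> measure P bad \<le> 2 * exp (- y)"
proof -
  interpret prob_space P by fact
  \<comment> \<open>Index shift: \<open>q n\<close> is the conditional variance of increment
    \<open>n + 1\<close> given \<open>F n\<close>.\<close>
  define q where "q n = real_cond_exp P (F n) (\<lambda>\<eta>. (Y (Suc n) \<eta>)\<^sup>2)" for n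
  \<comment> \<open>The hypotheses on \<open>Y\<close> hold almost surely and \<open>q\<close> is
    only a version, whereas the locale asks for pointwise bounds. Truncation gives modifications
    that agree almost everywhere.\<close>
  define Y' where "Y' n \<omega> = max (- 1) (min 1 (Y (Suc n) \<omega>))" for n \<omega>
  define s where "s n \<omega> = max 0 (min 1 (q n \<omega>))" for n \<omega>
  have cond: "finite_measure_subalgebra P (F n)" for n
    by unfold_locales (rule assms(3))
  have to_P: "f \<in> borel_measurable P" if "f \<in> borel_measurable (F n)" for n and f :: "'w \<Rightarrow> 'b::topological_space"
    using measurable_from_subalg[OF assms(3)] that .
  have XF: "X (Suc n) \<in> borel_measurable (F n)" for n using assms(4)[of "Suc n"] by simp
  have YF: "Y (Suc n) \<in> borel_measurable (F (Suc n))" for n using assms(6)[of "Suc n"] by simp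
  have qF [measurable]: "q n \<in> borel_measurable (F n)" for n unfolding q_def by simp
  have [measurable]: "X (Suc n) \<in> borel_measurable P" "Y (Suc n) \<in> borel_measurable P" "q n \<in> borel_measurable P" for n
    using to_P[OF XF] to_P[OF YF] to_P[OF qF] .
  have Y1: "AE \<omega> in P. \<bar>Y (Suc n) \<omega>\<bar> \<le> 1" for n using assms(8)[of "Suc n"] by simp
  have int_Y: "integrable P (Y (Suc n))" and int_Y2: "integrable P (\<lambda>\<omega>. (Y (Suc n) \<omega>)\<^sup>2)" for n
    using Y1[of n] by (auto intro!: integrable_const_bound[where B = 1] simp: abs_square_le_1)
  have q01: "AE \<omega> in P. 0 \<le> q n \<omega> \<and> q n \<omega> \<le> 1" for n
  proof -
    interpret finite_measure_subalgebra P "F n" by (rule cond)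
    have "AE \<omega> in P. 0 \<le> q n \<omega>" unfolding q_def by (rule real_cond_exp_pos) auto
    moreover have "AE \<omega> in P. q n \<omega> \<le> 1"
      unfolding q_def using Y1[of n] by (intro real_cond_exp_le_c int_Y2) (auto simp: abs_square_le_1)
    ultimately show ?thesis by eventually_elim simp
  qed
  have Y'_eq: "AE \<omega> in P. Y' n \<omega> = Y (Suc n) \<omega>" for n
    using Y1[of n] by eventually_elim (auto simp: Y'_def)
  have s_eq: "AE \<omega> in P. s n \<omega> = q n \<omega>" for n
    using q01[of n] by eventually_elim (auto simp: s_def)
  have Y'F: "Y' n \<in> borel_measurable (F (Suc n))" for n
    unfolding Y'_def[abs_def] using YF[of n] by measurable
  have [measurable]: "Y' n \<in> borel_measurable P" "s n \<in> borel_measurable P" for n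
    using to_P[OF Y'F] by (auto simp: s_def[abs_def])
  have Y'_cond: "(\<integral>\<omega>. \<phi> \<omega> * Y' n \<omega> \<partial>P) = 0"
      "(\<integral>\<omega>. \<phi> \<omega> * (Y' n \<omega>)\<^sup>2 \<partial>P) = (\<integral>\<omega>. \<phi> \<omega> * s n \<omega> \<partial>P)"
    if \<phi>: "\<phi> \<in> borel_measurable (F n)" "\<And>\<omega>. \<omega> \<in> space P \<Longrightarrow> \<bar>\<phi> \<omega>\<bar> \<le> B" for n \<phi> B
  proof -
    interpret finite_measure_subalgebra P "F n" by (rule cond)
    have [measurable]: "\<phi> \<in> borel_measurable P" by (rule to_P[OF \<phi>(1)])
    have int: "integrable P (\<lambda>\<omega>. \<phi> \<omega> * f \<omega>)" if "integrable P f" for f :: "'w \<Rightarrow> real"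
    proof (rule Bochner_Integration.integrable_bound)
      show "integrable P (\<lambda>\<omega>. B * f \<omega>)" using that by simp
      show "(\<lambda>\<omega>. \<phi> \<omega> * f \<omega>) \<in> borel_measurable P" using that by measurable
      show "AE \<omega> in P. norm (\<phi> \<omega> * f \<omega>) \<le> norm (B * f \<omega>)"
        using \<phi>(2) by (intro AE_I2) (force simp: abs_mult intro: mult_right_mono order_trans[OF _ abs_ge_self])
    qed
    have "(\<integral>\<omega>. \<phi> \<omega> * Y' n \<omega> \<partial>P) = (\<integral>\<omega>. \<phi> \<omega> * Y (Suc n) \<omega> \<partial>P)"
      using Y'_eq[of n] by (intro integral_cong_AE) (auto elim: eventually_mono)
    also have "\<dots> = (\<integral>\<omega>. \<phi> \<omega> * real_cond_exp P (F n) (Y (Suc n)) \<omega> \<partial>P)"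
      by (intro real_cond_exp_intg(2)[symmetric] int int_Y \<phi>) measurable
    also have "\<dots> = (\<integral>\<omega>. 0 \<partial>P)"
      using assms(7)[of "Suc n"] by (intro integral_cong_AE) (auto elim: eventually_mono)
    finally show "(\<integral>\<omega>. \<phi> \<omega> * Y' n \<omega> \<partial>P) = 0" by simp
    have "(\<integral>\<omega>. \<phi> \<omega> * (Y' n \<omega>)\<^sup>2 \<partial>P) = (\<integral>\<omega>. \<phi> \<omega> * (Y (Suc n) \<omega>)\<^sup>2 \<partial>P)"
      using Y'_eq[of n] by (intro integral_cong_AE) (auto elim: eventually_mono)
    also have "\<dots> = (\<integral>\<omega>. \<phi> \<omega> * q n \<omega> \<partial>P)"
      unfolding q_def by (intro real_cond_exp_intg(2)[symmetric] int int_Y2 \<phi>) measurable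
    also have "\<dots> = (\<integral>\<omega>. \<phi> \<omega> * s n \<omega> \<partial>P)"
      using s_eq[of n] by (intro integral_cong_AE) (auto elim: eventually_mono)
    finally show "(\<integral>\<omega>. \<phi> \<omega> * (Y' n \<omega>)\<^sup>2 \<partial>P) = (\<integral>\<omega>. \<phi> \<omega> * s n \<omega> \<partial>P)" .
  qed
  interpret B: bounded_increments P F "\<lambda>n. X (Suc n)" Y' s \<rho>
  proof
    show "norm (X (Suc n) \<omega>) \<le> 1" if "\<omega> \<in> space P" for n \<omega>
      using assms(5)[of "Suc n" \<omega>] that by simp
    show "s n \<in> borel_measurable (F n)" for n unfolding s_def[abs_def] by measurable
    show "\<bar>Y' n \<omega>\<bar> \<le> 1" "0 \<le> s n \<omega>" "s n \<omega> \<le> 1" for n \<omega>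
      by (auto simp: Y'_def s_def)
  qed (fact filtration.space_F[OF assms(2)] filtration.sets_F_mono[OF assms(2)] assms(3,9) XF Y'F Y'_cond)+
  have sum_shift: "(\<Sum>j=1..n. f j) = (\<Sum>i<n. f (Suc i))" for n and f :: "nat \<Rightarrow> 'b::comm_monoid_add"
    using sum.atLeast1_atMost_eq[of f n] by simp
  have gram: "gram_op X n \<omega> = (\<Sum>i<n. rank_one (X (Suc i) \<omega>))" for n \<omega>
    unfolding gram_op_def sum_shift ..
  \<comment> \<open>The raw version \<open>q\<close> appears here, not its truncation
    \<open>s\<close>, because the event is stated with the raw version.\<close>
  have Q: "pred_quad_var P F X Y n \<omega> = (\<Sum>i<n. q i \<omega> *\<^sub>R rank_one (X (Suc i) \<omega>))" for n \<omega>
    unfolding pred_quad_var_def sum_shift q_def by simp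
  have [measurable]: "(\<lambda>\<omega>. info_gain ((1 / \<rho>) *\<^sub>R gram_op X n \<omega>)) \<in> borel_measurable P" for n
    unfolding gram using assms(9) by (intro borel_measurable_info_gain_gram) auto
  have [measurable]: "self_norm P F X Y \<rho> n \<in> borel_measurable P" for n
    unfolding self_norm_def[abs_def]
  proof (rule borel_measurable_norm_inv_sqrt_op)
    show "symmetric_op (pred_quad_var P F X Y n \<omega> + \<rho> *\<^sub>R id_blinfun)" for \<omega>
      by (simp add: symmetric_op_def Q blinfun.add_left blinfun.scaleR_left blinfun.sum_left inner_add_left
          inner_add_right inner_sum_left inner_sum_right rank_one_apply inner_commute mult_ac)
    have "(\<lambda>\<omega>. (\<Sum>i<n. q i \<omega> * (X (Suc i) \<omega> \<bullet> x)\<^sup>2) + \<rho> * (x \<bullet> x)) \<in> borel_measurable P" for x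
      by measurable
    then show "(\<lambda>\<omega>. x \<bullet> blinfun_apply (pred_quad_var P F X Y n \<omega> + \<rho> *\<^sub>R id_blinfun) x) \<in> borel_measurable P" for x
      by (simp add: Q blinfun.add_left blinfun.scaleR_left blinfun.sum_left inner_add_right
          inner_sum_right inner_rank_one)
    show "mart_sum X Y n \<in> borel_measurable P"
      unfolding mart_sum_def[abs_def] sum_shift by measurable
  qed
  have bad: "bad \<in> sets P" unfolding bad_def by measurable
  define G where "G = {\<omega> \<in> space P. \<exists>n. sqrt \<rho> / 4 * sqrt \<rho> + y + (\<Sum>k<n. ln (1 + s k \<omega> * B.w k \<omega>)) / 4
    \<le> sqrt \<rho> / 4 * sqrt (B.U n \<omega> + \<rho>)}"
  have G: "G \<in> sets P" "prob G \<le> exp (- y)"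
    unfolding G_def by (rule B.self_normalised_tail)+
  have "AE \<omega> in P. \<forall>n. s n \<omega> = q n \<omega> \<and> Y' n \<omega> = Y (Suc n) \<omega>"
    using s_eq Y'_eq by (simp add: AE_all_countable)
  \<comment> \<open>Off a null set the truncated and the raw processes agree at all times
    simultaneously, so there the event can be compared with the one of the locale.\<close>
  then have "AE \<omega> in P. \<omega> \<in> bad \<longrightarrow> \<omega> \<in> G"
  proof eventually_elim
    case (elim \<omega>)
    show ?case
    proof
      assume "\<omega> \<in> bad"
      define \<gamma> where "\<gamma> n = info_gain ((1 / \<rho>) *\<^sub>R gram_op X n \<omega>)" for n
      obtain n where n: "sqrt \<rho> + (78 * \<gamma> n + 4 * y) / sqrt \<rho> + sqrt (18 * \<gamma> n + 6 * y) < self_norm P F X Y \<rho> n \<omega>"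
        and \<omega>: "\<omega> \<in> space P"
        using \<open>\<omega> \<in> bad\<close> by (auto simp: bad_def \<gamma>_def)
      have T: "pred_quad_var P F X Y n \<omega> + \<rho> *\<^sub>R id_blinfun = B.T n \<omega>"
        using elim by (simp add: Q B.T_def add.commute)
      have M: "mart_sum X Y n \<omega> = B.M n \<omega>"
        using elim unfolding mart_sum_def sum_shift B.M_def by simp
      have "self_norm P F X Y \<rho> n \<omega> = sqrt (B.U n \<omega>)"
        unfolding self_norm_def T M norm_inv_sqrt_op[OF B.coercive_T] B.U_def ..
      also have "\<dots> \<le> sqrt (B.U n \<omega> + \<rho>)" using assms(9) by simp
      finally have Z: "self_norm P F X Y \<rho> n \<omega> \<le> sqrt (B.U n \<omega> + \<rho>)" .
      let ?S = "\<Sum>k<n. ln (1 + s k \<omega> * B.w k \<omega>)"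
      have S0: "0 \<le> ?S"
        using B.s_ge B.w_nonneg by (intro sum_nonneg ln_ge_zero) simp
      have S: "?S \<le> 2 * \<gamma> n"
        using sum_ln_inv_form_le_info_gain[of \<rho> "\<lambda>k. s k \<omega>" "\<lambda>k. X (Suc k) \<omega>" n] assms(9) B.s_ge B.s_le
        by (simp add: \<gamma>_def gram B.w_def B.T_def)
      \<comment> \<open>\<open>S0\<close> and \<open>S\<close> together give
        \<open>\<gamma> n \<ge> 0\<close>, so \<open>2 \<gamma> n\<close> may be enlarged to
        \<open>78 \<gamma> n\<close>.\<close>
      have "sqrt \<rho> + (?S + 4 * y) / sqrt \<rho> \<le> sqrt \<rho> + (78 * \<gamma> n + 4 * y) / sqrt \<rho>"
        using S S0 assms(9) by (intro add_left_mono divide_right_mono) auto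
      also have "\<dots> \<le> sqrt \<rho> + (78 * \<gamma> n + 4 * y) / sqrt \<rho> + sqrt (18 * \<gamma> n + 6 * y)"
        using S S0 assms(10) by simp
      also have "\<dots> \<le> sqrt (B.U n \<omega> + \<rho>)" using n Z by simp
      finally have "sqrt \<rho> / 4 * (sqrt \<rho> + (?S + 4 * y) / sqrt \<rho>) \<le> sqrt \<rho> / 4 * sqrt (B.U n \<omega> + \<rho>)"
        using assms(9) by (intro mult_left_mono) auto
      \<comment> \<open>Multiplication by \<open>sqrt \<rho> / 4\<close> turns
        \<open>4 y / sqrt \<rho>\<close> into \<open>y\<close> and \<open>?S / sqrt \<rho>\<close>
        into \<open>?S / 4\<close>, the threshold that defines \<open>G\<close>.\<close>
      also have "sqrt \<rho> / 4 * (sqrt \<rho> + (?S + 4 * y) / sqrt \<rho>) = sqrt \<rho> / 4 * sqrt \<rho> + y + ?S / 4"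
        using assms(9) by (simp add: distrib_left del: real_sqrt_mult_self) (simp add: field_simps)
      finally show "\<omega> \<in> G" using \<omega> unfolding G_def by blast
    qed
  qed
  then have "prob bad \<le> prob G"
    using G bad by (intro finite_measure_mono_AE)
  also have "\<dots> \<le> exp (- y)" by (rule G)
  also have "\<dots> \<le> 2 * exp (- y)" by simp
  finally show ?thesis using bad by simp
qed

end
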